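(* Let $s_0\in\{1,2\}$, let $s\ge s_0$ be an integer, and let $c_0$ be an $s_0$-colouring of $T\cong \mathrm{PG}(1,2)$ (that is, a function $c_0:T\to\{1,\dots,s_0\}$ on the three points of $T$). Then there exists $C>0$ such that for every $n\in\mathbb N$ and every $c_0$-free $s$-colouring $c:\mathrm{PG}(n-1,2)\to\{1,\dots,s\}$, there is a subspace $V$ of $\mathrm{PG}(n-1,2)$ with $\dim(V)\ge Cn^{1/7}$ and a colour $i\in\{1,\dots,s\}$ such that no point of $V$ has colour $i$.
   Context: $\mathrm{PG}(n-1,2)$ is the binary projective geometry, whose points may be identified with the nonzero vectors of $\mathbb F_2^n$; a subspace of it is the set of nonzero vectors of a linear subspace of $\mathbb F_2^n$, and its dimension is the dimension of that linear subspace. $T=\mathrm{PG}(1,2)$ is the set of three nonzero vectors of $\mathbb F_2^2$. A colouring of a geometry is a function on its set of points. If $c$ is a colouring of $\mathrm{PG}(n-1,2)$ and $c_0$ a colouring of $\mathrm{PG}(k-1,2)$, then $c$ contains $c_0$ if there is an injective linear map $\psi:\mathbb F_2^k\to\mathbb F_2^n$ with $c(\psi(x))=c_0(x)$ for every nonzero $x\in\mathbb F_2^k$; $c$ is $c_0$-free if it does not contain $c_0$.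
   Formalization: The case s = 1, n = 1 is excluded: there the geometry is a single point of colour 1, the colouring is vacuously c_0-free, and the only subspace avoiding colour 1 is empty, of dimension 0 < C, so the claim fails. *)

theory Defs
  imports Complex_Main "HOL-Library.Z2" "Jordan_Normal_Form.VS_Connect"
begin

text \<open>The argument \<open>n\<close> below is the linear dimension, so it refers to the geometry \<open>PG(n-1,2)\<close>;
  \<open>T = PG(1,2)\<close> is the case \<open>n = 2\<close>.\<close>

abbreviation F2_space :: "nat \<Rightarrow> (bit, bit vec) module" where
  "F2_space n \<equiv> module_vec TYPE(bit) n"

definition pg_points :: "nat \<Rightarrow> bit vec set" where
  "pg_points n = carrier_vec n - {0\<^sub>v n}"

definition pg_subspace :: "nat \<Rightarrow> bit vec set \<Rightarrow> bool" where
  "pg_subspace n V \<longleftrightarrow> (\<exists>W. subspace class_ring W (F2_space n) \<and> V = W - {0\<^sub>v n})"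

text \<open>The linear subspace underlying \<open>V\<close> is recovered by adding the zero vector. The value is only
  meaningful when \<open>pg_subspace n V\<close> holds.\<close>

definition pg_dim :: "nat \<Rightarrow> bit vec set \<Rightarrow> nat" where
  "pg_dim n V = vectorspace.dim class_ring (F2_space n \<lparr>carrier := insert (0\<^sub>v n) V\<rparr>)"

text \<open>Colourings are total functions on \<open>bit vec\<close>; only their values on \<open>pg_points\<close> matter.\<close>

definition pg_colouring :: "nat \<Rightarrow> nat \<Rightarrow> (bit vec \<Rightarrow> nat) \<Rightarrow> bool" where
  "pg_colouring s n c \<longleftrightarrow> c \<in> pg_points n \<rightarrow> {1..s}"

definition pg_contains :: "nat \<Rightarrow> (bit vec \<Rightarrow> nat) \<Rightarrow> nat \<Rightarrow> (bit vec \<Rightarrow> nat) \<Rightarrow> bool" where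
  "pg_contains n c k c0 \<longleftrightarrow>
     (\<exists>\<psi>. linear_map class_ring (F2_space k) (F2_space n) \<psi> \<and> inj_on \<psi> (carrier_vec k) \<and>
          (\<forall>x\<in>pg_points k. c (\<psi> x) = c0 x))"

abbreviation pg_free :: "nat \<Rightarrow> (bit vec \<Rightarrow> nat) \<Rightarrow> nat \<Rightarrow> (bit vec \<Rightarrow> nat) \<Rightarrow> bool" where
  "pg_free n c k c0 \<equiv> \<not> pg_contains n c k c0"

text \<open>The statement over these definitions excludes the single case \<open>s = 1\<close>, \<open>n = 1\<close>. There the
  geometry is one point of colour \<open>1\<close>, which is free of every colouring of \<open>T\<close> because
  \<open>T\<close> does not embed, while the only subspace avoiding colour \<open>1\<close> is empty, of dimension \<open>0 < C\<close>.\<close>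

end

theory Submission
  imports Defs "HOL-Library.Function_Algebras"
begin

text \<open>
  Two of the three points of \<open>T\<close> have the same colour \<open>a\<close> under \<open>c\<^sub>0\<close>; let \<open>b\<close> be the colour of
  the third one. In a \<open>c\<^sub>0\<close>-free colouring the classes \<open>A\<close> and \<open>B\<close> of the colours \<open>a\<close> and \<open>b\<close>
  satisfy \<open>(A + A) \<inter> B = {}\<close>. Let \<open>k\<close> be a small multiple of the seventh root of \<open>n\<close>. If \<open>A\<close> has
  density below \<open>2^(-k)\<close>, or \<open>B\<close> does in some subspace of large dimension, a greedy choice gives a
  subspace of dimension about \<open>k\<close> that misses the set.

  Otherwise \<open>A\<close> admits density increments in the manner of Kelley and Meka, with a saving due to
  Bloom and Sisask. Indeed \<open>A + A\<close> misses a \<open>2^(-k)\<close> proportion of the current subspace \<open>V\<close>, so by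
  positivity of the Fourier transform some moment of order \<open>O(k)\<close> of the number of representations
  \<open>x = a + a'\<close> is large; sifting turns this into a set \<open>D\<close> of density \<open>2^(-O(k^2))\<close> almost all of
  whose sums are popular sums of \<open>A\<close>; almost periods of \<open>D\<close> (Croot and Sisask) together with Chang's
  bound yield a subspace of codimension \<open>O(k^6)\<close> in \<open>V\<close>, on a translate of which the density of \<open>A\<close>
  is larger by a factor \<open>33/32\<close>. Since the density is at most \<open>1\<close>, there are \<open>O(k)\<close> such steps.
\<close>

section \<open>Deviations of sums over random tuples\<close>

lemma exp_le_quadratic:
  fixes y :: real
  assumes "\<bar>y\<bar> \<le> 1"
  shows "exp y \<le> 1 + y + y\<^sup>2"
proof (cases "y \<ge> 0")
  case True
  then show ?thesis using exp_bound[of y] assms by simp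
next
  case False
  \<comment> \<open>For negative \<open>y\<close> it suffices to multiply the Taylor lower bound for
    \<open>exp z\<close> by \<open>1 - z + z\<^sup>2\<close> and to check that the product of the
    polynomials is at least 1.\<close>
  define z where "z = -y"
  have z: "0 \<le> z" "z \<le> 1" using False assms by (auto simp: z_def)
  have e: "1 + z + z\<^sup>2/2 \<le> exp z" using exp_lower_Taylor_quadratic[of z] z by simp
  have "1 \<le> (1 - z + z\<^sup>2) * (1 + z + z\<^sup>2/2)"
  proof -
    have "(1 - z + z\<^sup>2) * (1 + z + z\<^sup>2/2) = 1 + z\<^sup>2/2 + z^3/2 + z^4/2"
      by (simp add: field_simps power2_eq_square power3_eq_cube power4_eq_xxxx)
    then show ?thesis using z by simp
  qed
  also have "\<dots> \<le> (1 - z + z\<^sup>2) * exp z"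
  proof (rule mult_left_mono[OF e])
    have "0 \<le> z\<^sup>2" by simp
    then show "0 \<le> 1 - z + z\<^sup>2" using z by linarith
  qed
  finally have "exp y \<le> 1 - z + z\<^sup>2" by (simp add: z_def exp_minus field_simps)
  then show ?thesis by (simp add: z_def)
qed

text \<open>Chernoff's method: the coordinates of a uniform tuple are independent, so the
  exponential moment over all tuples is an \<open>l\<close>-th power, and Markov's inequality turns
  it into a tail bound.\<close>

lemma tuple_tail_bound:
  fixes u :: "'a \<Rightarrow> real"
  assumes fin: "finite D" and u1: "\<And>a. a \<in> D \<Longrightarrow> \<bar>u a\<bar> \<le> 1" and u0: "(\<Sum>a\<in>D. u a) = 0"
    and eta: "0 < \<eta>" "\<eta> \<le> 1"
  shows "real (card {g \<in> PiE {..<l::nat} (\<lambda>_. D). (\<Sum>i<l. u (g i)) > real l * \<eta>})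
          \<le> exp (- real l * \<eta>\<^sup>2 / 4) * real (card D) ^ l"
proof -
  define P where "P = PiE {..<l} (\<lambda>_. D)"
  \<comment> \<open>This value minimises the final exponent
    \<open>l * \<theta>\<^sup>2 - \<theta> * l * \<eta>\<close>.\<close>
  define \<theta> where "\<theta> = \<eta> / 2"
  have finP: "finite P" unfolding P_def by (intro finite_PiE) (auto simp: fin)
  let ?B = "{g \<in> P. (\<Sum>i<l. u (g i)) > real l * \<eta>}"
  have one: "(\<Sum>a\<in>D. exp (\<theta> * u a)) \<le> real (card D) * exp (\<theta>\<^sup>2)"
  proof -
    have "(\<Sum>a\<in>D. exp (\<theta> * u a)) \<le> (\<Sum>a\<in>D. 1 + \<theta> * u a + \<theta>\<^sup>2)"
    proof (rule sum_mono)
      fix a assume a: "a \<in> D"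
      have b: "\<bar>u a\<bar> \<le> 1" using u1[OF a] .
      have "\<bar>\<theta> * u a\<bar> \<le> 1 * 1"
        unfolding abs_mult using b eta by (intro mult_mono) (auto simp: \<theta>_def)
      then have "exp (\<theta> * u a) \<le> 1 + \<theta> * u a + (\<theta> * u a)\<^sup>2"
        by (intro exp_le_quadratic) simp
      moreover have "(\<theta> * u a)\<^sup>2 \<le> \<theta>\<^sup>2"
      proof -
        have "(u a)\<^sup>2 \<le> 1" using b abs_square_le_1 by blast
        then have "\<theta>\<^sup>2 * (u a)\<^sup>2 \<le> \<theta>\<^sup>2 * 1" by (intro mult_left_mono) auto
        then show ?thesis by (simp add: power_mult_distrib)
      qed
      ultimately show "exp (\<theta> * u a) \<le> 1 + \<theta> * u a + \<theta>\<^sup>2" by linarith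
    qed
    also have "\<dots> = real (card D) * (1 + \<theta>\<^sup>2)"
      using u0 by (simp add: sum.distrib sum_distrib_left[symmetric] algebra_simps)
    also have "\<dots> \<le> real (card D) * exp (\<theta>\<^sup>2)"
      by (intro mult_left_mono) auto
    finally show ?thesis .
  qed
  have "real (card ?B) * exp (\<theta> * (real l * \<eta>)) = (\<Sum>g\<in>?B. exp (\<theta> * (real l * \<eta>)))" by simp
  also have "\<dots> \<le> (\<Sum>g\<in>?B. exp (\<theta> * (\<Sum>i<l. u (g i))))"
    using eta by (intro sum_mono) (auto simp: \<theta>_def)
  also have "\<dots> \<le> (\<Sum>g\<in>P. exp (\<theta> * (\<Sum>i<l. u (g i))))"
    by (rule sum_mono2) (auto simp: finP)
  also have "\<dots> = (\<Sum>g\<in>P. \<Prod>i<l. exp (\<theta> * u (g i)))"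
    by (simp add: sum_distrib_left exp_sum)
  also have "\<dots> = (\<Prod>i<l. \<Sum>a\<in>D. exp (\<theta> * u a))"
    unfolding P_def by (subst prod_sum_PiE) (auto simp: fin)
  also have "\<dots> = (\<Sum>a\<in>D. exp (\<theta> * u a)) ^ l" by simp
  also have "\<dots> \<le> (real (card D) * exp (\<theta>\<^sup>2)) ^ l"
    by (intro power_mono one sum_nonneg) auto
  also have "\<dots> = real (card D) ^ l * exp (real l * \<theta>\<^sup>2)"
    by (simp add: power_mult_distrib exp_of_nat_mult)
  finally have "real (card ?B) * exp (\<theta> * (real l * \<eta>)) \<le> real (card D) ^ l * exp (real l * \<theta>\<^sup>2)" .
  then have "real (card ?B) \<le> real (card D) ^ l * exp (real l * \<theta>\<^sup>2) * exp (- (\<theta> * (real l * \<eta>)))"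
    by (simp add: exp_minus field_simps)
  also have "\<dots> = real (card D) ^ l * exp (real l * \<theta>\<^sup>2 - \<theta> * (real l * \<eta>))"
    by (simp add: exp_diff exp_minus field_simps)
  also have "real l * \<theta>\<^sup>2 - \<theta> * (real l * \<eta>) = - real l * \<eta>\<^sup>2 / 4"
    by (simp add: \<theta>_def power2_eq_square field_simps)
  finally show ?thesis by (simp add: P_def mult.commute)
qed

lemma tuple_deviation_bound:
  fixes u :: "'a \<Rightarrow> real"
  assumes fin: "finite D" and u1: "\<And>a. a \<in> D \<Longrightarrow> \<bar>u a\<bar> \<le> 1" and u0: "(\<Sum>a\<in>D. u a) = 0"
    and eta: "0 < \<eta>" "\<eta> \<le> 1"
  shows "real (card {g \<in> PiE {..<l::nat} (\<lambda>_. D). \<bar>\<Sum>i<l. u (g i)\<bar> > real l * \<eta>})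
          \<le> 2 * exp (- real l * \<eta>\<^sup>2 / 4) * real (card D) ^ l"
proof -
  let ?P = "PiE {..<l} (\<lambda>_. D)"
  let ?B = "{g \<in> ?P. (\<Sum>i<l. u (g i)) > real l * \<eta>}"
  let ?C = "{g \<in> ?P. (\<Sum>i<l. - u (g i)) > real l * \<eta>}"
  have finP: "finite ?P" by (intro finite_PiE) (auto simp: fin)
  have "{g \<in> ?P. \<bar>\<Sum>i<l. u (g i)\<bar> > real l * \<eta>} \<subseteq> ?B \<union> ?C"
    by (auto simp: sum_negf abs_if split: if_splits)
  then have "card {g \<in> ?P. \<bar>\<Sum>i<l. u (g i)\<bar> > real l * \<eta>} \<le> card (?B \<union> ?C)"
    by (rule card_mono[rotated]) (auto simp: finP)
  also have "\<dots> \<le> card ?B + card ?C" by (rule card_Un_le)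
  finally have "real (card {g \<in> ?P. \<bar>\<Sum>i<l. u (g i)\<bar> > real l * \<eta>}) \<le> real (card ?B) + real (card ?C)"
    by linarith
  moreover have "real (card ?B) \<le> exp (- real l * \<eta>\<^sup>2 / 4) * real (card D) ^ l"
    by (rule tuple_tail_bound[OF fin u1 u0 eta])
  moreover have "real (card ?C) \<le> exp (- real l * \<eta>\<^sup>2 / 4) * real (card D) ^ l"
    by (rule tuple_tail_bound[OF fin, of "\<lambda>a. - u a"]) (auto simp: u1 u0 eta sum_negf)
  ultimately show ?thesis by linarith
qed

lemma sum_if_card:
  assumes "finite A"
  shows "(\<Sum>x\<in>A. if P x then c else 0) = of_nat (card {x \<in> A. P x}) * (c :: 'b::comm_semiring_1)"
  by (simp add: sum.inter_filter[OF assms, symmetric])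

section \<open>Finite groups of exponent two and their characters\<close>

text \<open>The characters of all subgroups \<open>V\<close> of \<open>G\<close> are handled as restrictions of characters of \<open>G\<close>, so
  Fourier sums always range over the dual \<open>I\<close> of the ambient group.\<close>

locale binary_dual =
  fixes G :: "'a::ab_group_add set" and I :: "'i set" and \<chi> :: "'i \<Rightarrow> 'a \<Rightarrow> real"
  assumes add_self [simp]: "\<And>x::'a. x + x = 0"
    and finite_G: "finite G" and zero_G: "0 \<in> G" and add_G: "\<And>x y. x \<in> G \<Longrightarrow> y \<in> G \<Longrightarrow> x + y \<in> G"
    and finite_I: "finite I"
    and \<chi>_pm: "\<And>i x. \<chi> i x = 1 \<or> \<chi> i x = - 1"
    and \<chi>_add: "\<And>i x y. \<chi> i (x + y) = \<chi> i x * \<chi> i y"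
    and \<chi>_complete: "\<And>x. x \<in> G \<Longrightarrow> (\<Sum>i\<in>I. \<chi> i x) = (if x = 0 then real (card I) else 0)"
    and I_nonempty: "I \<noteq> {}"
begin

definition subgrp :: "'a set \<Rightarrow> bool" where
  "subgrp V \<longleftrightarrow> V \<subseteq> G \<and> 0 \<in> V \<and> (\<forall>x\<in>V. \<forall>y\<in>V. x + y \<in> V)"

text \<open>The convolution of the indicator of \<open>A\<close> with itself: sums and differences
  coincide, so \<open>rep A x\<close> counts ordered pairs in \<open>A\<close> with sum
  \<open>x\<close>.\<close>

definition rep :: "'a set \<Rightarrow> 'a \<Rightarrow> nat" where
  "rep A x = card {a \<in> A. x + a \<in> A}"

definition hat :: "'a set \<Rightarrow> 'i \<Rightarrow> real" where
  "hat A i = (\<Sum>x\<in>A. \<chi> i x)"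

lemma add_left_self [simp]: "x + (x + y) = (y::'a)"
  by (simp add: add.assoc[symmetric])

lemma add_right_self [simp]: "(y + x) + x = (y::'a)"
  by (simp add: add.assoc)

lemma add_eq_0_iff' : "(x::'a) + y = 0 \<longleftrightarrow> y = x"
  by (metis add_left_self add_self add.right_neutral)

lemma subgrpD: "subgrp V \<Longrightarrow> V \<subseteq> G" "subgrp V \<Longrightarrow> 0 \<in> V"
    "subgrp V \<Longrightarrow> x \<in> V \<Longrightarrow> y \<in> V \<Longrightarrow> x + y \<in> V"
    "subgrp V \<Longrightarrow> finite V" "subgrp V \<Longrightarrow> V \<noteq> {}" "subgrp V \<Longrightarrow> card V > 0"
proof -
  assume V: "subgrp V"
  show 1: "V \<subseteq> G" "0 \<in> V" using V by (auto simp: subgrp_def)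
  show "x \<in> V \<Longrightarrow> y \<in> V \<Longrightarrow> x + y \<in> V" using V by (auto simp: subgrp_def)
  show 2: "finite V" using 1 finite_G finite_subset by blast
  show "V \<noteq> {}" using 1 by blast
  show "card V > 0" using 1 2 by (auto simp: card_gt_0_iff)
qed

lemma subgrp_G: "subgrp G"
  using zero_G add_G by (auto simp: subgrp_def)

lemma sum_shift:
  assumes "subgrp V" "t \<in> V"
  shows "(\<Sum>x\<in>V. F (x + t)) = (\<Sum>x\<in>V. F x)"
  by (rule sum.reindex_bij_witness[of _ "\<lambda>x. x + t" "\<lambda>x. x + t"])
     (use assms subgrpD(3) in auto)

lemma card_shift:
  assumes "subgrp V" "t \<in> V"
  shows "card {x \<in> V. P (x + t)} = card {x \<in> V. P x}"
  by (rule bij_betw_same_card[of "\<lambda>x. x + t"], rule bij_betwI[of _ _ _ "\<lambda>x. x + t"])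
     (use assms subgrpD(3) in auto)

lemma \<chi>_0 [simp]: "\<chi> i 0 = 1"
  using \<chi>_add[of i 0 0] \<chi>_pm[of i 0] by auto

lemma \<chi>_abs [simp]: "\<bar>\<chi> i x\<bar> = 1"
  using \<chi>_pm[of i x] by auto

lemma card_I_pos: "0 < real (card I)"
  using finite_I I_nonempty by (simp add: card_gt_0_iff)

section \<open>Fourier analysis and moments of the representation function\<close>

text \<open>Fourier inversion for a convolution square. Expanding \<open>(hat A i)\<^sup>2\<close>
  and summing over \<open>i\<close> first, completeness leaves only the pairs with sum
  \<open>x\<close>.\<close>

lemma rep_fourier:
  assumes A: "A \<subseteq> G" and x: "x \<in> G"
  shows "real (card I) * real (rep A x) = (\<Sum>i\<in>I. (hat A i)\<^sup>2 * \<chi> i x)"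
proof -
  have finA: "finite A" using A finite_G finite_subset by blast
  have "(hat A i)\<^sup>2 = (\<Sum>a\<in>A. \<Sum>b\<in>A. \<chi> i a * \<chi> i b)" for i
    by (simp add: hat_def power2_eq_square sum_product)
  then have "(\<Sum>i\<in>I. (hat A i)\<^sup>2 * \<chi> i x) = (\<Sum>i\<in>I. \<Sum>a\<in>A. \<Sum>b\<in>A. \<chi> i (x + a + b))"
    by (simp only: \<chi>_add sum_distrib_left mult_ac)
  also have "\<dots> = (\<Sum>a\<in>A. \<Sum>b\<in>A. \<Sum>i\<in>I. \<chi> i (x + a + b))"
    by (subst sum.swap) (intro sum.cong refl sum.swap)
  also have "\<dots> = (\<Sum>a\<in>A. \<Sum>b\<in>A. if b = x + a then real (card I) else 0)"
    by (intro sum.cong refl, subst \<chi>_complete) (use A x in \<open>auto simp: add_eq_0_iff' intro!: add_G\<close>)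
  also have "\<dots> = (\<Sum>a\<in>A. if x + a \<in> A then real (card I) else 0)"
    using finA by (simp add: sum.delta)
  also have "\<dots> = real (card I) * real (rep A x)"
    using finA by (simp add: rep_def sum_if_card)
  finally show ?thesis by simp
qed

text \<open>A shift by a point where \<psi> is -1 negates the sum. The function \<psi> need not be
  one of the \<open>\<chi> i\<close>, because the lemma is also applied to products of
  characters.\<close>

lemma character_sum:
  assumes V: "subgrp V" and "\<And>x. x \<in> V \<Longrightarrow> \<psi> x = 1 \<or> \<psi> x = (-1::real)"
    and "\<And>x y. x \<in> V \<Longrightarrow> y \<in> V \<Longrightarrow> \<psi> (x + y) = \<psi> x * \<psi> y"
  shows "(\<Sum>x\<in>V. \<psi> x) = (if \<forall>x\<in>V. \<psi> x = 1 then real (card V) else 0)"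
proof (cases "\<forall>x\<in>V. \<psi> x = 1")
  case False
  then obtain t where t: "t \<in> V" "\<psi> t = -1" using assms(2) by blast
  have "(\<Sum>x\<in>V. \<psi> x) = (\<Sum>x\<in>V. \<psi> (x + t))" by (simp add: sum_shift[OF V t(1)])
  also have "\<dots> = - (\<Sum>x\<in>V. \<psi> x)" using assms(3) t by (simp add: sum_negf)
  finally have "(\<Sum>x\<in>V. \<psi> x) = 0" by simp
  then show ?thesis by (subst if_not_P[OF False])
qed auto

text \<open>The Fourier coefficients of \<open>|V| rep A / |A|\<^sup>2 - 1\<close> on \<open>V\<close> are nonnegative, and
  this is preserved by powers.\<close>

lemma rep_moment_nonneg:
  assumes V: "subgrp V" and A: "A \<subseteq> V" "A \<noteq> {}"
  defines "f \<equiv> \<lambda>x. real (card V) * real (rep A x) / (real (card A))\<^sup>2"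
  shows "(\<Sum>x\<in>V. (f x - 1) ^ q) \<ge> 0"
proof -
  have finA: "finite A" using A subgrpD(4)[OF V] finite_subset by blast
  have cA: "real (card A) > 0" using A finA by (simp add: card_gt_0_iff)
  \<comment> \<open>The Fourier coefficient of \<open>f - 1\<close> on \<open>V\<close>. For a
    character trivial on \<open>V\<close> both terms equal \<open>card V\<close> and cancel; for any
    other \<open>hat V i\<close> vanishes and a square remains.\<close>
  define c where "c i = real (card V) / (real (card A))\<^sup>2 * (hat A i)\<^sup>2 - hat V i" for i
  have hatV: "hat V i = (if \<forall>x\<in>V. \<chi> i x = 1 then real (card V) else 0)" for i
    unfolding hat_def by (rule character_sum[OF V \<chi>_pm \<chi>_add])
  have c0: "c i \<ge> 0" for i
  proof (cases "\<forall>x\<in>V. \<chi> i x = 1")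
    case True
    then have "\<forall>x\<in>A. \<chi> i x = 1" using A by blast
    then have "hat A i = real (card A)" by (simp add: hat_def)
    then show ?thesis using True cA by (simp add: c_def hatV)
  next
    case False
    then have "hat V i = 0" using hatV by auto
    then show ?thesis by (simp add: c_def)
  qed
  have rep: "real (card I) * (f x - 1) = (\<Sum>i\<in>I. c i * \<chi> i x)" if x: "x \<in> V" for x
  proof -
    have "(\<Sum>i\<in>I. hat V i * \<chi> i x) = (\<Sum>y\<in>V. \<Sum>i\<in>I. \<chi> i (x + y))"
      unfolding hat_def sum_distrib_right by (subst sum.swap) (simp add: \<chi>_add mult.commute)
    also have "\<dots> = (\<Sum>y\<in>V. if y = x then real (card I) else 0)"
      by (intro sum.cong refl, subst \<chi>_complete)
         (use x V in \<open>auto simp: add_eq_0_iff' intro!: add_G dest: subgrpD(1)\<close>)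
    also have "\<dots> = real (card I)" using x subgrpD(4)[OF V] by simp
    finally have 1: "(\<Sum>i\<in>I. hat V i * \<chi> i x) = real (card I)" .
    have 2: "real (card I) * real (rep A x) = (\<Sum>i\<in>I. (hat A i)\<^sup>2 * \<chi> i x)"
      by (rule rep_fourier) (use A x subgrpD(1)[OF V] in auto)
    have "(\<Sum>i\<in>I. c i * \<chi> i x) = real (card V) / (real (card A))\<^sup>2 * (\<Sum>i\<in>I. (hat A i)\<^sup>2 * \<chi> i x)
        - (\<Sum>i\<in>I. hat V i * \<chi> i x)"
      by (simp add: c_def left_diff_distrib sum_subtractf sum_distrib_left mult.assoc)
    also have "\<dots> = real (card I) * (f x - 1)"
      unfolding 1 2[symmetric] by (simp add: f_def algebra_simps)
    finally show ?thesis by simp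
  qed
  \<comment> \<open>The twist by \<psi> makes the induction on \<open>q\<close> work: expanding one
    factor \<open>f - 1\<close> produces characters \<open>\<chi> i\<close>, which are absorbed into
    \<psi>, with nonnegative weights \<open>c i\<close>.\<close>
  have "(\<Sum>x\<in>V. (f x - 1) ^ q * \<psi> x) \<ge> 0"
    if "\<And>x. x \<in> V \<Longrightarrow> \<psi> x = 1 \<or> \<psi> x = -1"
       "\<And>x y. x \<in> V \<Longrightarrow> y \<in> V \<Longrightarrow> \<psi> (x + y) = \<psi> x * \<psi> y" for \<psi> :: "'a \<Rightarrow> real"
    using that
  proof (induction q arbitrary: \<psi>)
    case 0
    then show ?case using character_sum[OF V, of \<psi>] by simp
  next
    case (Suc q)
    have "real (card I) * (\<Sum>x\<in>V. (f x - 1) ^ Suc q * \<psi> x)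
        = (\<Sum>x\<in>V. (real (card I) * (f x - 1)) * ((f x - 1) ^ q * \<psi> x))"
      by (simp add: sum_distrib_left mult_ac)
    also have "\<dots> = (\<Sum>x\<in>V. \<Sum>i\<in>I. c i * ((f x - 1) ^ q * (\<chi> i x * \<psi> x)))"
      by (intro sum.cong refl) (simp add: rep sum_distrib_left sum_distrib_right mult_ac)
    also have "\<dots> = (\<Sum>i\<in>I. c i * (\<Sum>x\<in>V. (f x - 1) ^ q * (\<chi> i x * \<psi> x)))"
      by (subst sum.swap) (simp add: sum_distrib_left)
    also have "\<dots> \<ge> 0"
    proof (rule sum_nonneg, rule mult_nonneg_nonneg[OF c0], rule Suc.IH)
      fix i x assume "x \<in> V"
      then show "\<chi> i x * \<psi> x = 1 \<or> \<chi> i x * \<psi> x = - 1"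
        using Suc.prems(1)[of x] \<chi>_pm[of i x] by auto
    next
      fix i x y assume "x \<in> V" "y \<in> V"
      then show "\<chi> i (x + y) * \<psi> (x + y) = \<chi> i x * \<psi> x * (\<chi> i y * \<psi> y)"
        by (simp add: \<chi>_add Suc.prems(2))
    qed
    finally show ?case using card_I_pos by (simp add: zero_le_mult_iff)
  qed
  from this[of "\<lambda>_. 1"] show ?thesis by simp
qed

text \<open>The pointwise inequality below holds by Bernoulli on \<open>f \<ge> 5/4\<close>, and elsewhere because its
  right-hand side is nonpositive.\<close>

lemma rep_moment_large:
  assumes V: "subgrp V" and A: "A \<subseteq> V" "A \<noteq> {}" and q: "odd q"
    and Z: "real (card V) \<le> 2 ^ q * real (card {x \<in> V. rep A x = 0})"
  defines "f \<equiv> \<lambda>x. real (card V) * real (rep A x) / (real (card A))\<^sup>2"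
  shows "real (card V) * (9/8) ^ (5 * q) * (2 ^ q - 1) \<le> (\<Sum>x\<in>V. f x ^ (5 * q))"
proof -
  \<comment> \<open>The factor \<open>4 ^ q\<close> turns the error \<open>(1/4) ^ q\<close> into 1,
    and \<open>(9/8) ^ (5 * q)\<close> is the scale against which the moment is measured.\<close>
  define K :: real where "K = (9/8) ^ (5 * q) * 4 ^ q"
  have K: "K > 0" by (simp add: K_def)
  have f0: "f x \<ge> 0" for x by (simp add: f_def)
  have pt: "K * ((f x - 1) ^ q - (1/4) ^ q + (if rep A x = 0 then 1 else 0)) \<le> f x ^ (5 * q)" for x
  proof (cases "f x \<ge> 5/4")
    case True
    then have r: "rep A x \<noteq> 0" by (intro notI) (simp add: f_def)
    \<comment> \<open>With \<open>f x = (5/4) * (1 + y)\<close>, the number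
      \<open>4 * (f x - 1)\<close> is \<open>1 + 5 * y\<close>, whence the exponent 5 in Bernoulli's
      inequality. The spare factor 10/9 lowers the base from 5/4 to 9/8.\<close>
    define y where "y = f x * (4/5) - 1"
    have y: "y \<ge> 0" using True by (simp add: y_def)
    have fx: "f x = (5/4) * (1 + y)" by (simp add: y_def)
    have "4 * (f x - 1) = 1 + real 5 * y" by (simp add: fx algebra_simps)
    also have "\<dots> \<le> (1 + y) ^ 5" by (rule Bernoulli_inequality) (use y in auto)
    also have "\<dots> \<le> (10/9 * (1 + y)) ^ 5" by (rule power_mono) (use y in auto)
    also have "10/9 * (1 + y) = f x / (9/8)" by (simp add: fx)
    finally have "4 * (f x - 1) \<le> (f x / (9/8)) ^ 5" .
    then have "(4 * (f x - 1)) ^ q \<le> ((f x / (9/8)) ^ 5) ^ q"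
      by (rule power_mono) (use True in auto)
    also have "\<dots> = f x ^ (5 * q) / (9/8) ^ (5 * q)"
      by (simp add: power_mult power_divide)
    finally have "(4 * (f x - 1)) ^ q \<le> f x ^ (5 * q) / (9/8) ^ (5 * q)" .
    then have "(9/8) ^ (5 * q) * (4 * (f x - 1)) ^ q \<le> f x ^ (5 * q)"
      by (subst (asm) pos_le_divide_eq) (simp_all only: mult.commute zero_less_power zero_less_divide_iff zero_less_numeral simp_thms)
    then have "K * (f x - 1) ^ q \<le> f x ^ (5 * q)"
      by (simp only: K_def power_mult_distrib mult.assoc)
    moreover have "K * (1/4) ^ q \<ge> 0" using K by simp
    ultimately show ?thesis using r by (simp add: algebra_simps)
  next
    case False
    have "(f x - 1) ^ q - (1/4) ^ q + (if rep A x = 0 then 1 else 0) \<le> 0"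
    proof (cases "rep A x = 0")
      case True
      \<comment> \<open>Here \<open>f x = 0\<close>, and \<open>q\<close> odd makes
        \<open>(f x - 1) ^ q = -1\<close>, which cancels the indicator.\<close>
      then show ?thesis using q by (simp add: f_def)
    next
      case r: False
      have "(f x - 1) ^ q \<le> (1/4) ^ q"
      proof (cases "f x \<ge> 1")
        case True
        then show ?thesis using False by (intro power_mono) auto
      next
        case False
        then have "(f x - 1) ^ q \<le> 0" using q by (simp add: power_le_zero_eq odd_pos)
        also have "0 \<le> (1/4::real) ^ q" by simp
        finally show ?thesis .
      qed
      then show ?thesis using r by simp
    qed
    then have "K * ((f x - 1) ^ q - (1/4) ^ q + (if rep A x = 0 then 1 else 0)) \<le> 0"
      using K by (simp add: mult_le_0_iff)
    also have "0 \<le> f x ^ (5 * q)" using f0 by simp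
    finally show ?thesis .
  qed
  let ?z = "real (card {x \<in> V. rep A x = 0})"
  have ind: "(\<Sum>x\<in>V. if rep A x = 0 then 1 else 0) = ?z"
    using subgrpD(4)[OF V] by (simp add: sum_if_card)
  have "K * ((\<Sum>x\<in>V. (f x - 1) ^ q) - real (card V) * (1/4) ^ q + ?z) \<le> (\<Sum>x\<in>V. f x ^ (5 * q))"
    unfolding ind[symmetric]
    using sum_mono[of V "\<lambda>x. K * ((f x - 1) ^ q - (1/4) ^ q + (if rep A x = 0 then 1 else 0))" "\<lambda>x. f x ^ (5 * q)"] pt
    by (simp only: sum_distrib_left[symmetric] sum.distrib sum_subtractf sum_constant)
  moreover have "K * (- real (card V) * (1/4) ^ q + ?z) \<le> K * ((\<Sum>x\<in>V. (f x - 1) ^ q) - real (card V) * (1/4) ^ q + ?z)"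
    using rep_moment_nonneg[OF V A, of q] K by (intro mult_left_mono) (auto simp: f_def)
  \<comment> \<open>The unrepresented points have density at least \<open>2 ^ (-q)\<close>, so after
    multiplication by \<open>4 ^ q\<close> they contribute \<open>2 ^ q * card V\<close>, against an
    error of only \<open>card V\<close>.\<close>
  moreover have "real (card V) * (9/8) ^ (5 * q) * (2 ^ q - 1) \<le> K * (- real (card V) * (1/4) ^ q + ?z)"
  proof -
    have "(2::real) ^ q * 2 ^ q = 4 ^ q" by (simp add: power_mult_distrib[symmetric])
    moreover have "2 ^ q * real (card V) \<le> 2 ^ q * (2 ^ q * ?z)" using Z by (intro mult_left_mono) auto
    ultimately have "2 ^ q * real (card V) \<le> 4 ^ q * ?z" by (simp add: mult.assoc[symmetric])
    then have "(9/8) ^ (5 * q) * (2 ^ q * real (card V) - real (card V)) \<le> (9/8) ^ (5 * q) * (4 ^ q * ?z - real (card V))"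
      by (intro mult_left_mono) auto
    moreover have "(4::real) ^ q * (1/4) ^ q = 1" by (simp add: power_mult_distrib[symmetric])
    moreover have "K * (- real (card V) * (1/4) ^ q + ?z)
        = (9/8) ^ (5 * q) * (4 ^ q * ?z - (4 ^ q * (1/4) ^ q) * real (card V))"
      unfolding K_def by (simp only: algebra_simps)
    ultimately show ?thesis by (simp add: algebra_simps)
  qed
  ultimately show ?thesis by linarith
qed

end

section \<open>Averaging, sifting and almost periods\<close>

lemma exists_ge_average:
  fixes F :: "'b \<Rightarrow> real"
  assumes "finite S" "S \<noteq> {}" "c * real (card S) \<le> (\<Sum>x\<in>S. F x)"
  shows "\<exists>x\<in>S. c \<le> F x"
proof (rule ccontr)
  assume "\<not> ?thesis"
  then have "(\<Sum>x\<in>S. F x) < (\<Sum>x\<in>S. c)" by (intro sum_strict_mono assms) auto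
  then show False using assms by (simp add: mult.commute)
qed

lemma card_tuples_all:
  assumes "finite V"
  shows "card {s \<in> PiE {..<p::nat} (\<lambda>_. V). \<forall>i<p. Q (s i)} = card {v \<in> V. Q v} ^ p"
proof -
  have "{s \<in> PiE {..<p} (\<lambda>_. V). \<forall>i<p. Q (s i)} = PiE {..<p} (\<lambda>_. {v \<in> V. Q v})"
    by (auto simp: PiE_def Pi_def)
  then show ?thesis by (simp add: card_PiE)
qed

lemma sum_card_swap:
  assumes "finite S" "finite R"
  shows "(\<Sum>s\<in>S. card {r \<in> R. Q s r}) = (\<Sum>r\<in>R. card {s \<in> S. Q s r})"
proof -
  have "(\<Sum>s\<in>S. card {r \<in> R. Q s r}) = (\<Sum>s\<in>S. \<Sum>r\<in>R. if Q s r then 1 else 0)"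
    using sum_if_card[OF assms(2), where c = "1::nat"] by simp
  also have "\<dots> = (\<Sum>r\<in>R. \<Sum>s\<in>S. if Q s r then 1 else 0)" by (rule sum.swap)
  also have "\<dots> = (\<Sum>r\<in>R. card {s \<in> S. Q s r})"
    using sum_if_card[OF assms(1), where c = "1::nat"] by simp
  finally show ?thesis .
qed

context binary_dual
begin

text \<open>In exponent two this is the intersection within \<open>V\<close> of the translates
  \<open>A + s i\<close>, the random set used for sifting.\<close>

definition shifts :: "'a set \<Rightarrow> 'a set \<Rightarrow> nat \<Rightarrow> (nat \<Rightarrow> 'a) \<Rightarrow> 'a set" where
  "shifts V A p s = {x \<in> V. \<forall>i<p. x + s i \<in> A}"

lemma sum_card_shifts:
  assumes V: "subgrp V" and A: "A \<subseteq> V"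
  shows "(\<Sum>s\<in>PiE {..<p} (\<lambda>_. V). card (shifts V A p s)) = card V * card A ^ p"
proof -
  note finV = subgrpD(4)[OF V]
  have c: "card {v \<in> V. x + v \<in> A} = card A" if "x \<in> V" for x
  proof -
    have "card {v \<in> V. v + x \<in> A} = card {v \<in> V. v \<in> A}" by (rule card_shift[OF V that])
    also have "{v \<in> V. v \<in> A} = A" using A by blast
    finally show ?thesis by (simp add: add.commute)
  qed
  have "(\<Sum>s\<in>PiE {..<p} (\<lambda>_. V). card (shifts V A p s))
      = (\<Sum>x\<in>V. card {s \<in> PiE {..<p} (\<lambda>_. V). \<forall>i<p. x + s i \<in> A})"
    unfolding shifts_def by (rule sum_card_swap) (auto intro: finite_PiE simp: finV)
  also have "\<dots> = (\<Sum>x\<in>V. card A ^ p)"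
    by (intro sum.cong refl) (simp add: card_tuples_all[OF finV, where Q = "\<lambda>v. _ + v \<in> A"] c)
  finally show ?thesis by simp
qed

text \<open>Second moment of the random set: for each coordinate, the shifts carrying both
  \<open>x\<close> and \<open>y\<close> into \<open>A\<close> number \<open>rep A (x + y)\<close>,
  so a pair is counted with the \<open>p\<close>-th power of that.\<close>

lemma sum_card_shift_pairs:
  assumes V: "subgrp V" and A: "A \<subseteq> V"
  shows "(\<Sum>s\<in>PiE {..<p} (\<lambda>_. V). card {z \<in> shifts V A p s \<times> shifts V A p s. H (fst z + snd z)})
     = card V * (\<Sum>z\<in>V. if H z then rep A z ^ p else 0)"
proof -
  note finV = subgrpD(4)[OF V]
  let ?P = "PiE {..<p} (\<lambda>_. V)"
  have c: "card {v \<in> V. x + v \<in> A \<and> y + v \<in> A} = rep A (x + y)" if "x \<in> V" "y \<in> V" for x y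
  proof -
    have "card {v \<in> V. v + x \<in> A \<and> (x + y) + (v + x) \<in> A} = card {v \<in> V. v \<in> A \<and> (x + y) + v \<in> A}"
      by (rule card_shift[OF V that(1)])
    moreover have e1: "(x + y) + (v + x) = y + v" for v
      by (metis add.assoc add.commute add_right_self)
    have "{v \<in> V. v + x \<in> A \<and> (x + y) + (v + x) \<in> A} = {v \<in> V. x + v \<in> A \<and> y + v \<in> A}"
      unfolding e1 by (simp only: add.commute[of x])
    moreover have "{v \<in> V. v \<in> A \<and> (x + y) + v \<in> A} = {a \<in> A. (x + y) + a \<in> A}" using A by blast
    ultimately show ?thesis by (simp only: rep_def)
  qed
  have *: "{z \<in> shifts V A p s \<times> shifts V A p s. H (fst z + snd z)}
      = {z \<in> {z \<in> V \<times> V. H (fst z + snd z)}. \<forall>i<p. fst z + s i \<in> A \<and> snd z + s i \<in> A}" for s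
    by (auto simp: shifts_def)
  have "(\<Sum>s\<in>?P. card {z \<in> shifts V A p s \<times> shifts V A p s. H (fst z + snd z)})
      = (\<Sum>z\<in>{z \<in> V \<times> V. H (fst z + snd z)}.
           card {s \<in> ?P. \<forall>i<p. fst z + s i \<in> A \<and> snd z + s i \<in> A})"
    unfolding * by (rule sum_card_swap) (auto intro: finite_PiE simp: finV)
  also have "\<dots> = (\<Sum>z\<in>{z \<in> V \<times> V. H (fst z + snd z)}. rep A (fst z + snd z) ^ p)"
    by (intro sum.cong refl) (auto simp: card_tuples_all[OF finV, where Q = "\<lambda>v. _ + v \<in> A \<and> _ + v \<in> A"] c)
  also have "\<dots> = (\<Sum>z\<in>V \<times> V. if H (fst z + snd z) then rep A (fst z + snd z) ^ p else 0)"
    by (rule sum.inter_filter) (simp add: finV)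
  also have "\<dots> = (\<Sum>x\<in>V. \<Sum>y\<in>V. if H (x + y) then rep A (x + y) ^ p else 0)"
    by (simp add: sum.cartesian_product case_prod_unfold)
  also have "\<dots> = (\<Sum>x\<in>V. \<Sum>y\<in>V. if H (y + x) then rep A (y + x) ^ p else 0)"
    by (simp only: add.commute)
  also have "\<dots> = (\<Sum>x\<in>V. \<Sum>y\<in>V. if H y then rep A y ^ p else 0)"
    by (intro sum.cong refl sum_shift[OF V, where F = "\<lambda>y. if H y then rep A y ^ p else 0"])
  finally show ?thesis by simp
qed

text \<open>Dependent random choice: a random intersection of \<open>p\<close> translates of \<open>A\<close> weights its sums by the
  \<open>p\<close>-th power of \<open>rep A\<close>.\<close>

lemma sifting:
  assumes V: "subgrp V" and A: "A \<subseteq> V" "A \<noteq> {}"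
  defines "f \<equiv> \<lambda>x. real (card V) * real (rep A x) / (real (card A))\<^sup>2"
  assumes M: "256 * (9/8) ^ p * real (card V) \<le> (\<Sum>x\<in>V. f x ^ p)"
  shows "\<exists>D\<subseteq>V. D \<noteq> {} \<and> (real (card A) / real (card V)) ^ p \<le> 2 * (real (card D) / real (card V)) \<and>
    64 * real (card {z \<in> D \<times> D. f (fst z + snd z) < 9/8}) \<le> (real (card D))\<^sup>2"
proof (rule ccontr)
  assume contra: "\<not> ?thesis"
  note finV = subgrpD(4)[OF V]
  have finA: "finite A" using A finV finite_subset by blast
  have cV: "real (card V) > 0" using subgrpD(6)[OF V] by simp
  have cA: "real (card A) > 0" using A finA by (simp add: card_gt_0_iff)
  let ?P = "PiE {..<p} (\<lambda>_. V)"
  let ?E = "shifts V A p"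
  \<comment> \<open>Half the average size of \<open>?E s\<close> over all tuples
    \<open>s\<close>.\<close>
  define \<theta> where "\<theta> = (real (card A) / real (card V)) ^ p * real (card V) / 2"
  have \<theta>: "\<theta> > 0" using cA cV by (simp add: \<theta>_def)
  \<comment> \<open>The mean of \<open>rep A\<close> on \<open>V\<close>, so \<open>f\<close> is
    \<open>rep A\<close> normalised to mean 1.\<close>
  define \<beta> where "\<beta> = (real (card A))\<^sup>2 / real (card V)"
  have \<beta>: "\<beta> > 0" using cA cV by (simp add: \<beta>_def)
  have repf: "real (rep A x) = \<beta> * f x" for x using cA cV by (simp add: f_def \<beta>_def)
  have f0: "f x \<ge> 0" for x by (simp add: f_def)
  \<comment> \<open>A set smaller than \<theta> is paid for by the linear term. A larger one is
    dense enough to serve as \<open>D\<close>, so by the contrary assumption it has many unpopular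
    pairs.\<close>
  have each: "(real (card (?E s)))\<^sup>2 \<le> \<theta> * real (card (?E s))
      + 64 * real (card {z \<in> ?E s \<times> ?E s. f (fst z + snd z) < 9/8})" for s
  proof (cases "\<theta> \<le> real (card (?E s))")
    case True
    have "?E s \<subseteq> V" by (auto simp: shifts_def)
    moreover have "?E s \<noteq> {}" using True \<theta> by auto
    moreover have "(real (card A) / real (card V)) ^ p \<le> 2 * (real (card (?E s)) / real (card V))"
      using True cV by (simp add: \<theta>_def field_simps)
    ultimately have "(real (card (?E s)))\<^sup>2 < 64 * real (card {z \<in> ?E s \<times> ?E s. f (fst z + snd z) < 9/8})"
      using contra by (meson not_le)
    moreover have "\<theta> * real (card (?E s)) \<ge> 0" using \<theta> by simp
    ultimately show ?thesis by linarith
  next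
    case False
    then have "real (card (?E s)) * real (card (?E s)) \<le> \<theta> * real (card (?E s))"
      by (intro mult_right_mono) auto
    then show ?thesis by (simp add: power2_eq_square)
  qed
  have sq: "(\<Sum>s\<in>?P. (real (card (?E s)))\<^sup>2) = real (card V) * \<beta> ^ p * (\<Sum>x\<in>V. f x ^ p)"
  proof -
    have "card {z \<in> ?E s \<times> ?E s. True} = (card (?E s))\<^sup>2" for s
      by (simp add: card_cartesian_product power2_eq_square del: mem_Times_iff)
    then have "(\<Sum>s\<in>?P. (card (?E s))\<^sup>2) = card V * (\<Sum>z\<in>V. rep A z ^ p)"
      using sum_card_shift_pairs[OF V A(1), of p "\<lambda>_. True"] by simp
    then have "real (\<Sum>s\<in>?P. (card (?E s))\<^sup>2) = real (card V * (\<Sum>z\<in>V. rep A z ^ p))" by (rule arg_cong)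
    then show ?thesis by (simp add: repf power_mult_distrib sum_distrib_left mult.assoc)
  qed
  have lin: "(\<Sum>s\<in>?P. real (card (?E s))) = real (card V) * real (card A) ^ p"
    using arg_cong[OF sum_card_shifts[OF V A(1), of p], of real] by simp
  have bad: "(\<Sum>s\<in>?P. real (card {z \<in> ?E s \<times> ?E s. f (fst z + snd z) < 9/8}))
      \<le> real (card V) * \<beta> ^ p * (real (card V) * (9/8) ^ p)"
  proof -
    have "(\<Sum>s\<in>?P. real (card {z \<in> ?E s \<times> ?E s. f (fst z + snd z) < 9/8}))
        = real (card V * (\<Sum>z\<in>V. if f z < 9/8 then rep A z ^ p else 0))"
      using arg_cong[OF sum_card_shift_pairs[OF V A(1), of p "\<lambda>z. f z < 9/8"], of real] by simp
    also have "\<dots> = real (card V) * (\<Sum>z\<in>V. if f z < 9/8 then (\<beta> * f z) ^ p else 0)"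
      by (auto simp: repf intro!: sum.cong)
    also have "\<dots> \<le> real (card V) * (\<Sum>z\<in>V. \<beta> ^ p * (9/8) ^ p)"
    proof (intro mult_left_mono sum_mono)
      fix z
      have "(\<beta> * f z) ^ p \<le> (\<beta> * (9/8)) ^ p" if "f z < 9/8"
        using that \<beta> f0 by (intro power_mono mult_left_mono mult_nonneg_nonneg) auto
      then show "(if f z < 9/8 then (\<beta> * f z) ^ p else 0) \<le> \<beta> ^ p * (9/8) ^ p"
        using \<beta> by (simp add: power_mult_distrib[symmetric])
    qed auto
    finally show ?thesis by (simp add: mult_ac)
  qed
  have "(\<Sum>s\<in>?P. (real (card (?E s)))\<^sup>2)
      \<le> (\<Sum>s\<in>?P. \<theta> * real (card (?E s)) + 64 * real (card {z \<in> ?E s \<times> ?E s. f (fst z + snd z) < 9/8}))"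
    by (rule sum_mono) (rule each)
  also have "\<dots> = \<theta> * (\<Sum>s\<in>?P. real (card (?E s)))
      + 64 * (\<Sum>s\<in>?P. real (card {z \<in> ?E s \<times> ?E s. f (fst z + snd z) < 9/8}))"
    by (simp only: sum.distrib sum_distrib_left)
  finally have "real (card V) * \<beta> ^ p * (\<Sum>x\<in>V. f x ^ p)
      \<le> \<theta> * (real (card V) * real (card A) ^ p) + 64 * (real (card V) * \<beta> ^ p * (real (card V) * (9/8) ^ p))"
    using bad unfolding sq lin by linarith
  also have "\<theta> * (real (card V) * real (card A) ^ p) = real (card V) * \<beta> ^ p * (real (card V) / 2)"
    using cV by (simp add: \<theta>_def \<beta>_def power_divide power_mult[symmetric] field_simps power2_eq_square
        power_mult_distrib)
  finally have "real (card V) * \<beta> ^ p * (\<Sum>x\<in>V. f x ^ p)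
      \<le> real (card V) * \<beta> ^ p * (real (card V) / 2 + 64 * (real (card V) * (9/8) ^ p))"
    by (simp only: distrib_left mult_ac)
  then have le: "(\<Sum>x\<in>V. f x ^ p) \<le> real (card V) / 2 + 64 * (real (card V) * (9/8) ^ p)"
    using cV \<beta> by (subst (asm) mult_le_cancel_left_pos) auto
  \<comment> \<open>Since \<open>(9/8) ^ p \<ge> 1\<close>, the upper bound \<open>le\<close> is at
    most 64.5 times \<open>card V * (9/8) ^ p\<close>, well below the assumed 256.\<close>
  have "real (card V) * 1 \<le> real (card V) * (9/8) ^ p" by (intro mult_left_mono one_le_power) auto
  moreover have "256 * (real (card V) * (9/8) ^ p) \<le> (\<Sum>x\<in>V. f x ^ p)" using M by (simp only: mult_ac)
  ultimately show False using le cV by linarith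
qed

text \<open>A random \<open>l\<close>-tuple from \<open>D\<close> approximates \<open>h\<close> outside a small set. By averaging some tuple has
  many translates that are such samples, and the difference of two of these shifts almost fixes \<open>h\<close>.\<close>

lemma almost_periods:
  fixes S :: "'a set"
  assumes V: "subgrp V" and D: "D \<subseteq> V" "D \<noteq> {}" and eta: "0 < \<eta>" "\<eta> \<le> 1" and l: "l > 0"
  defines "h \<equiv> \<lambda>x. real (card {a \<in> D. x + a \<in> S}) / real (card D)"
  shows "\<exists>T\<subseteq>V. T \<noteq> {} \<and> (real (card D) / real (card V)) ^ l * real (card V) \<le> 2 * real (card T) \<and>
    (\<forall>t\<in>T. real (card {x \<in> V. \<bar>h (x + t) - h x\<bar> > 2 * \<eta>}) \<le> 8 * exp (- real l * \<eta>\<^sup>2 / 4) * real (card V))"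
proof -
  note finV = subgrpD(4)[OF V]
  have finD: "finite D" using D finV finite_subset by blast
  have cV: "real (card V) > 0" using subgrpD(6)[OF V] by simp
  have cD: "real (card D) > 0" using D finD by (simp add: card_gt_0_iff)
  define e where "e = exp (- real l * \<eta>\<^sup>2 / 4)"
  have e: "e > 0" by (simp add: e_def)
  define w where "w y = (if y \<in> S then 1 else 0 :: real)" for y
  \<comment> \<open>The points at which the empirical average along the sample \<open>g\<close>
    misses \<open>h\<close> by more than \<eta>.\<close>
  define bad where "bad g = {x \<in> V. \<bar>\<Sum>i<l. w (x + g i) - h x\<bar> > real l * \<eta>}" for g
  let ?PD = "PiE {..<l} (\<lambda>_. D)" and ?PV = "PiE {..<l} (\<lambda>_. V)"
  have finP: "finite ?PD" "finite ?PV" by (auto intro!: finite_PiE simp: finD finV)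
  have h: "h x = (\<Sum>a\<in>D. w (x + a)) / real (card D)" for x
    by (simp add: h_def w_def sum_if_card[OF finD])
  have h01: "0 \<le> h x" "h x \<le> 1" for x
    using cD card_mono[of D "{a \<in> D. x + a \<in> S}"] finD by (auto simp: h_def divide_le_eq_1)
  have "(\<Sum>g\<in>?PD. card (bad g)) = (\<Sum>x\<in>V. card {g \<in> ?PD. \<bar>\<Sum>i<l. w (x + g i) - h x\<bar> > real l * \<eta>})"
    unfolding bad_def by (rule sum_card_swap) (auto simp: finP finV)
  from arg_cong[OF this, of real]
  have "(\<Sum>g\<in>?PD. real (card (bad g)))
      = (\<Sum>x\<in>V. real (card {g \<in> ?PD. \<bar>\<Sum>i<l. w (x + g i) - h x\<bar> > real l * \<eta>}))"
    by (simp only: of_nat_sum)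
  also have "\<dots> \<le> (\<Sum>x\<in>V. 2 * e * real (card D) ^ l)"
  proof (rule sum_mono)
    fix x assume "x \<in> V"
    show "real (card {g \<in> ?PD. \<bar>\<Sum>i<l. w (x + g i) - h x\<bar> > real l * \<eta>}) \<le> 2 * e * real (card D) ^ l"
      unfolding e_def
    proof (rule tuple_deviation_bound[OF finD _ _ eta, where u = "\<lambda>a. w (x + a) - h x"])
      show "\<bar>w (x + a) - h x\<bar> \<le> 1" for a using h01[of x] by (auto simp: w_def)
      show "(\<Sum>a\<in>D. w (x + a) - h x) = 0" using cD by (simp add: sum_subtractf h)
    qed
  qed
  finally have total: "(\<Sum>g\<in>?PD. real (card (bad g))) \<le> real (card V) * (2 * e * real (card D) ^ l)" by simp
  \<comment> \<open>The average size of \<open>bad g\<close> is at most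
    \<open>2 * e * card V\<close>; Markov's inequality with twice this value keeps at least half of
    the tuples.\<close>
  define Gd where "Gd = {g \<in> ?PD. real (card (bad g)) \<le> 4 * e * real (card V)}"
  have Gd_card: "real (card D) ^ l \<le> 2 * real (card Gd)"
  proof -
    let ?N = "?PD - Gd"
    have finN: "finite ?N" and sub: "Gd \<subseteq> ?PD" using finP by (auto simp: Gd_def)
    have "real (card ?N) * (4 * e * real (card V)) \<le> (\<Sum>g\<in>?N. real (card (bad g)))"
    proof (rule sum_bounded_below)
      fix g assume "g \<in> ?N"
      then have "\<not> real (card (bad g)) \<le> 4 * e * real (card V)" unfolding Gd_def by blast
      then show "4 * e * real (card V) \<le> real (card (bad g))" by linarith
    qed
    also have "\<dots> \<le> (\<Sum>g\<in>?PD. real (card (bad g)))" by (rule sum_mono2) (use finP in simp_all)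
    also note total
    finally have "(2 * e * real (card V)) * (2 * real (card ?N)) \<le> (2 * e * real (card V)) * real (card D) ^ l"
      by (simp add: mult_ac)
    then have "2 * real (card ?N) \<le> real (card D) ^ l" using e cV by simp
    moreover have "real (card ?N) = real (card D) ^ l - real (card Gd)"
    proof -
      have "card ?N = card ?PD - card Gd" using sub finP by (simp add: card_Diff_subset finite_subset)
      moreover have "card Gd \<le> card ?PD" using sub finP by (simp add: card_mono)
      ultimately show ?thesis by (simp add: card_PiE of_nat_diff)
    qed
    ultimately show ?thesis by linarith
  qed
  define tr where "tr t b = restrict (\<lambda>i. b i + t) {..<l}" for t and b :: "nat \<Rightarrow> 'a"
  have trtr: "tr t (tr t b) = b" if "b \<in> ?PV" for t b
    using that by (auto simp: tr_def fun_eq_iff PiE_def extensional_def)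
  have trV: "tr t b \<in> ?PV" if "b \<in> ?PV" "t \<in> V" for t b
    using that subgrpD(3)[OF V] by (auto simp: tr_def PiE_def)
  have GdV: "Gd \<subseteq> ?PV" using D by (auto simp: Gd_def PiE_def Pi_def)
  have "(\<Sum>b\<in>?PV. card {t \<in> V. tr t b \<in> Gd}) = (\<Sum>t\<in>V. card {b \<in> ?PV. tr t b \<in> Gd})"
    by (rule sum_card_swap) (auto simp: finP finV)
  also have "\<dots> = (\<Sum>t\<in>V. card Gd)"
  proof (intro sum.cong refl)
    fix t assume t: "t \<in> V"
    show "card {b \<in> ?PV. tr t b \<in> Gd} = card Gd"
      by (rule bij_betw_same_card[of "tr t"], rule bij_betwI[of _ _ _ "tr t"])
         (use trtr trV[OF _ t] GdV in \<open>auto simp: subset_iff\<close>)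
  qed
  finally have "real (\<Sum>b\<in>?PV. card {t \<in> V. tr t b \<in> Gd}) = real (card V * card Gd)" by simp
  then have sumT: "(\<Sum>b\<in>?PV. real (card {t \<in> V. tr t b \<in> Gd})) = real (card V) * real (card Gd)" by simp
  \<comment> \<open>For each \<open>t\<close> the shift \<open>tr t\<close> permutes the tuples over
    \<open>V\<close>, so on average over \<open>b\<close> the proportion of \<open>t\<close> with
    \<open>tr t b\<close> good is the density of \<open>Gd\<close>.\<close>
  have "\<exists>b\<in>?PV. real (card D) ^ l * real (card V) / (2 * real (card V) ^ l) \<le> real (card {t \<in> V. tr t b \<in> Gd})"
  proof (rule exists_ge_average[OF finP(2)])
    show "?PV \<noteq> {}" using subgrpD(5)[OF V] by (simp add: PiE_eq_empty_iff)
    have "real (card D) ^ l * real (card V) / (2 * real (card V) ^ l) * real (card ?PV)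
        = real (card V) * (real (card D) ^ l / 2)"
      using cV by (simp add: card_PiE)
    also have "\<dots> \<le> real (card V) * real (card Gd)" using Gd_card cV by (intro mult_left_mono) auto
    finally show "real (card D) ^ l * real (card V) / (2 * real (card V) ^ l) * real (card ?PV)
        \<le> (\<Sum>b\<in>?PV. real (card {t \<in> V. tr t b \<in> Gd}))" using sumT by simp
  qed
  then obtain b where b: "b \<in> ?PV" and
    bT: "real (card D) ^ l * real (card V) / (2 * real (card V) ^ l) \<le> real (card {t \<in> V. tr t b \<in> Gd})" by blast
  define T0 where "T0 = {t \<in> V. tr t b \<in> Gd}"
  have "real (card T0) > 0"
  proof -
    have "0 < real (card D) ^ l * real (card V) / (2 * real (card V) ^ l)" using cV cD by simp
    then show ?thesis using bT unfolding T0_def by linarith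
  qed
  then obtain t0 where t0: "t0 \<in> T0" by fastforce
  \<comment> \<open>Translating by the fixed \<open>t0\<close> compares two good shifts of one base
    tuple \<open>b\<close>, and places 0 in \<open>T\<close>.\<close>
  define T where "T = (\<lambda>t. t + t0) ` T0"
  have close: "\<bar>(\<Sum>i<l. w (x + t + b i)) - real l * h x\<bar> \<le> real l * \<eta>"
    if "t \<in> T0" "x \<in> V" "x \<notin> bad (tr t b)" for t x
  proof -
    have "(\<Sum>i<l. w (x + tr t b i) - h x) = (\<Sum>i<l. w (x + t + b i)) - real l * h x"
      by (simp add: sum_subtractf tr_def add_ac)
    then show ?thesis using that by (simp add: bad_def not_less)
  qed
  have "real (card {x \<in> V. \<bar>h (x + (t + t0)) - h x\<bar> > 2 * \<eta>}) \<le> 8 * e * real (card V)" if t: "t \<in> T0" for t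
  proof -
    let ?B = "bad (tr t b)" and ?C = "{x \<in> V. x + (t + t0) \<in> bad (tr t0 b)}"
    have tt: "t \<in> V" "t0 \<in> V" "t + t0 \<in> V" using t t0 subgrpD(3)[OF V] by (auto simp: T0_def)
    have "{x \<in> V. \<bar>h (x + (t + t0)) - h x\<bar> > 2 * \<eta>} \<subseteq> ?B \<union> ?C"
    proof (rule subsetI, rule ccontr)
      fix x assume x: "x \<in> {x \<in> V. \<bar>h (x + (t + t0)) - h x\<bar> > 2 * \<eta>}" and n: "x \<notin> ?B \<union> ?C"
      have xV: "x \<in> V" "x + (t + t0) \<in> V" using x tt subgrpD(3)[OF V] by auto
      have 1: "\<bar>(\<Sum>i<l. w (x + t + b i)) - real l * h x\<bar> \<le> real l * \<eta>"
        using close[OF t xV(1)] n by simp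
      \<comment> \<open>Both good samples are evaluated at the same points
        \<open>x + t + b i\<close>, so this one sum approximates both \<open>h x\<close> and
        \<open>h (x + (t + t0))\<close>. The two exceptional sets account for the factor 8.\<close>
      have "x + (t + t0) + t0 = x + t" by (simp add: add.assoc)
      then have 2: "\<bar>(\<Sum>i<l. w (x + t + b i)) - real l * h (x + (t + t0))\<bar> \<le> real l * \<eta>"
        using close[OF t0 xV(2)] n xV unfolding \<open>x + (t + t0) + t0 = x + t\<close> by simp
      have "real l * \<bar>h (x + (t + t0)) - h x\<bar> = \<bar>real l * h (x + (t + t0)) - real l * h x\<bar>"
        by (simp add: abs_mult right_diff_distrib[symmetric])
      also have "\<dots> \<le> real l * (2 * \<eta>)" using 1 2 by linarith
      finally show False using x l by simp
    qed
    then have "card {x \<in> V. \<bar>h (x + (t + t0)) - h x\<bar> > 2 * \<eta>} \<le> card (?B \<union> ?C)"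
      by (rule card_mono[rotated]) (auto simp: bad_def finV)
    also have "\<dots> \<le> card ?B + card ?C" by (rule card_Un_le)
    also have "card ?C = card {x \<in> V. x \<in> bad (tr t0 b)}" by (rule card_shift[OF V tt(3)])
    also have "{x \<in> V. x \<in> bad (tr t0 b)} = bad (tr t0 b)" by (auto simp: bad_def)
    finally have "real (card {x \<in> V. \<bar>h (x + (t + t0)) - h x\<bar> > 2 * \<eta>}) \<le> real (card ?B) + real (card (bad (tr t0 b)))"
      by linarith
    moreover have "real (card ?B) \<le> 4 * e * real (card V)" "real (card (bad (tr t0 b))) \<le> 4 * e * real (card V)"
      using t t0 by (auto simp: T0_def Gd_def)
    ultimately show ?thesis by linarith
  qed
  then have "\<forall>t\<in>T. real (card {x \<in> V. \<bar>h (x + t) - h x\<bar> > 2 * \<eta>}) \<le> 8 * e * real (card V)"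
    by (auto simp: T_def)
  moreover have "T \<subseteq> V" "T \<noteq> {}" using t0 subgrpD(3)[OF V] by (auto simp: T_def T0_def)
  moreover have "card T = card T0" unfolding T_def by (intro card_image inj_onI) simp
  then have "(real (card D) / real (card V)) ^ l * real (card V) \<le> 2 * real (card T)"
    using bT cV by (simp add: T0_def power_divide field_simps)
  ultimately show ?thesis unfolding e_def by blast
qed

section \<open>Chang's bound and the large spectrum\<close>

text \<open>The characters have order two, so for finite sets this is linear independence over F_2
  of the restrictions to \<open>V\<close>, written multiplicatively.\<close>

definition dissociated :: "'a set \<Rightarrow> 'i set \<Rightarrow> bool" where
  "dissociated V \<Lambda> \<longleftrightarrow> (\<forall>X\<subseteq>\<Lambda>. X \<noteq> {} \<longrightarrow> (\<exists>x\<in>V. (\<Prod>i\<in>X. \<chi> i x) \<noteq> 1))"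

lemma prod_character:
  "(\<Prod>i\<in>X. \<chi> i x) = 1 \<or> (\<Prod>i\<in>X. \<chi> i x) = -1"
  "(\<Prod>i\<in>X. \<chi> i (x + y)) = (\<Prod>i\<in>X. \<chi> i x) * (\<Prod>i\<in>X. \<chi> i y)"
proof -
  have "\<bar>\<Prod>i\<in>X. \<chi> i x\<bar> = 1" by (simp add: abs_prod)
  then show "(\<Prod>i\<in>X. \<chi> i x) = 1 \<or> (\<Prod>i\<in>X. \<chi> i x) = -1" by linarith
qed (simp add: \<chi>_add prod.distrib)

text \<open>A Riesz product: the exponential factors over \<Lambda>, and when the product is
  expanded and summed over \<open>V\<close>, dissociativity kills every term but that of the empty
  set.\<close>

lemma dissociated_exp_moment:
  assumes V: "subgrp V" and \<Lambda>: "finite \<Lambda>" "dissociated V \<Lambda>" and \<epsilon>: "\<And>i. \<epsilon> i = 1 \<or> \<epsilon> i = (-1::real)"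
  shows "(\<Sum>x\<in>V. exp ((\<Sum>i\<in>\<Lambda>. \<epsilon> i * \<chi> i x) / 4)) \<le> real (card V) * exp (real (card \<Lambda>) / 16)"
proof -
  define c s :: real where "c = cosh (1/4)" and "s = sinh (1/4)"
  \<comment> \<open>On the two values of a sign the exponential is affine, with coefficients
    \<open>sinh (1/4)\<close> and \<open>cosh (1/4)\<close>.\<close>
  have e: "exp (\<epsilon> i * \<chi> i x / 4) = \<epsilon> i * \<chi> i x * s + c" for i x
    using \<epsilon>[of i] \<chi>_pm[of i x] by (auto simp: c_def s_def cosh_def sinh_def field_simps)
  have c0: "c \<ge> 0" by (simp add: c_def cosh_def)
  have "exp (1/4::real) \<le> 1 + 1/4 + (1/4)\<^sup>2" "exp (-1/4::real) \<le> 1 + (-1/4) + (-1/4)\<^sup>2"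
    using exp_le_quadratic[of "1/4"] exp_le_quadratic[of "-1/4"] by simp_all
  then have "c \<le> 1 + 1/16" by (simp add: c_def cosh_def power2_eq_square)
  also have "\<dots> \<le> exp (1/16)" by (rule exp_ge_add_one_self)
  finally have c: "c \<le> exp (1/16)" .
  have z: "(\<Sum>x\<in>V. \<Prod>i\<in>X. \<chi> i x) = 0" if "X \<in> Pow \<Lambda>" "X \<noteq> {}" for X
  proof -
    have "\<not> (\<forall>x\<in>V. (\<Prod>i\<in>X. \<chi> i x) = 1)" using \<Lambda>(2) that by (auto simp: dissociated_def)
    then show ?thesis
      using character_sum[OF V, of "\<lambda>x. \<Prod>i\<in>X. \<chi> i x", OF prod_character] by (simp only: if_False)
  qed
  have "(\<Sum>x\<in>V. exp ((\<Sum>i\<in>\<Lambda>. \<epsilon> i * \<chi> i x) / 4)) = (\<Sum>x\<in>V. \<Prod>i\<in>\<Lambda>. \<epsilon> i * \<chi> i x * s + c)"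
    by (simp add: sum_divide_distrib exp_sum[OF \<Lambda>(1)] e)
  also have "\<dots> = (\<Sum>x\<in>V. \<Sum>X\<in>Pow \<Lambda>. (\<Prod>i\<in>X. \<epsilon> i * s) * c ^ card (\<Lambda> - X) * (\<Prod>i\<in>X. \<chi> i x))"
    by (simp add: prod_add[OF \<Lambda>(1)] prod.distrib mult_ac)
  also have "\<dots> = (\<Sum>X\<in>Pow \<Lambda>. (\<Prod>i\<in>X. \<epsilon> i * s) * c ^ card (\<Lambda> - X) * (\<Sum>x\<in>V. \<Prod>i\<in>X. \<chi> i x))"
    by (subst sum.swap) (simp add: sum_distrib_left)
  also have "\<dots> = (\<Sum>X\<in>Pow \<Lambda>. if X = {} then c ^ card \<Lambda> * real (card V) else 0)"
    by (intro sum.cong refl) (simp add: z)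
  also have "\<dots> = c ^ card \<Lambda> * real (card V)" using \<Lambda>(1) by simp
  also have "\<dots> \<le> exp (1/16) ^ card \<Lambda> * real (card V)"
    using c0 c by (intro mult_right_mono power_mono) auto
  also have "exp (1/16::real) ^ card \<Lambda> = exp (real (card \<Lambda>) / 16)"
    by (simp add: exp_of_nat_mult[symmetric])
  finally show ?thesis by (simp add: mult.commute)
qed

text \<open>Chang's bound: the large characters have a large correlation with \<open>T\<close> simultaneously, while
  dissociated characters behave like independent signs.\<close>

lemma dissociated_card_le:
  assumes V: "subgrp V" and T: "T \<subseteq> V" "T \<noteq> {}" and \<Lambda>: "finite \<Lambda>" "dissociated V \<Lambda>"
    and large: "\<And>i. i \<in> \<Lambda> \<Longrightarrow> real (card T) / 2 \<le> \<bar>hat T i\<bar>"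
    and d: "real (card V) \<le> real (card T) * exp (real d / 16)"
  shows "card \<Lambda> \<le> d"
proof -
  have finT: "finite T" using T subgrpD(4)[OF V] finite_subset by blast
  have cT: "real (card T) > 0" using T finT by (simp add: card_gt_0_iff)
  define n where "n = real (card \<Lambda>)"
  \<comment> \<open>The signs align the large coefficients, so each member of \<Lambda> adds at
    least \<open>card T / 2\<close> to the sum of \<open>Z\<close> over \<open>T\<close>.\<close>
  define \<epsilon> where "\<epsilon> i = (if hat T i \<ge> 0 then 1 else -1 :: real)" for i
  define Z where "Z x = (\<Sum>i\<in>\<Lambda>. \<epsilon> i * \<chi> i x)" for x
  have "(\<Sum>x\<in>T. Z x) = (\<Sum>i\<in>\<Lambda>. \<epsilon> i * hat T i)"
    unfolding Z_def hat_def by (subst sum.swap) (simp add: sum_distrib_left)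
  also have "\<dots> \<ge> (\<Sum>i\<in>\<Lambda>. real (card T) / 2)"
  proof (rule sum_mono)
    fix i assume "i \<in> \<Lambda>"
    then show "real (card T) / 2 \<le> \<epsilon> i * hat T i" using large[of i] by (auto simp: \<epsilon>_def)
  qed
  finally have ZT: "n * real (card T) / 2 \<le> (\<Sum>x\<in>T. Z x)" by (simp add: n_def)
  have "(\<Sum>x\<in>T. 1 + (Z x / 4 - n / 8)) = real (card T) + ((\<Sum>x\<in>T. Z x) / 4 - real (card T) * (n / 8))"
    by (simp add: sum.distrib sum_subtractf sum_divide_distrib)
  \<comment> \<open>Jensen's inequality by hand: \<open>Z / 4\<close> has mean at least
    \<open>n / 8\<close> on \<open>T\<close>, and \<open>exp\<close> lies above its tangent line at
    \<open>n / 8\<close>.\<close>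
  then have "exp (n / 8) * real (card T) \<le> exp (n / 8) * (\<Sum>x\<in>T. 1 + (Z x / 4 - n / 8))"
    using ZT by (intro mult_left_mono) simp_all
  also have "\<dots> = (\<Sum>x\<in>T. exp (n / 8) * (1 + (Z x / 4 - n / 8)))" by (rule sum_distrib_left)
  also have "\<dots> \<le> (\<Sum>x\<in>T. exp (n / 8) * exp (Z x / 4 - n / 8))"
    by (intro sum_mono mult_left_mono exp_ge_add_one_self) auto
  also have "\<dots> = (\<Sum>x\<in>T. exp (Z x / 4))" by (simp add: exp_add[symmetric])
  also have "\<dots> \<le> (\<Sum>x\<in>V. exp (Z x / 4))"
    by (rule sum_mono2) (use subgrpD(4)[OF V] T in auto)
  also have "\<dots> \<le> real (card V) * exp (n / 16)"
    unfolding Z_def n_def by (rule dissociated_exp_moment[OF V \<Lambda>]) (simp add: \<epsilon>_def)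
  also have "\<dots> \<le> real (card T) * exp (real d / 16) * exp (n / 16)"
    by (rule mult_right_mono[OF d]) simp
  finally have "real (card T) * exp (n / 8) \<le> real (card T) * exp (real d / 16 + n / 16)"
    by (simp add: exp_add mult_ac)
  then have "exp (n / 8) \<le> exp (real d / 16 + n / 16)" using cT by simp
  then have "n \<le> real d" unfolding exp_le_cancel_iff by simp
  then show ?thesis by (simp add: n_def)
qed

text \<open>Two points with the same sign pattern on \<Lambda> differ by an element of the kernel,
  and there are at most \<open>2 ^ card \<Lambda>\<close> patterns.\<close>

lemma common_kernel_card:
  assumes V: "subgrp V" and \<Lambda>: "finite \<Lambda>"
  shows "card V \<le> 2 ^ card \<Lambda> * card {x \<in> V. \<forall>i\<in>\<Lambda>. \<chi> i x = 1}"
proof -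
  note finV = subgrpD(4)[OF V]
  define W where "W = {x \<in> V. \<forall>i\<in>\<Lambda>. \<chi> i x = 1}"
  define \<kappa> where "\<kappa> x = {i \<in> \<Lambda>. \<chi> i x = 1}" for x
  have fib: "card {x \<in> V. \<kappa> x = Y} \<le> card W" for Y
  proof (cases "{x \<in> V. \<kappa> x = Y} = {}")
    case False
    then obtain x0 where x0: "x0 \<in> V" "\<kappa> x0 = Y" by blast
    have sub: "(\<lambda>x. x + x0) ` {x \<in> V. \<kappa> x = Y} \<subseteq> W"
    proof
      fix y assume "y \<in> (\<lambda>x. x + x0) ` {x \<in> V. \<kappa> x = Y}"
      then obtain x where x: "x \<in> V" "\<kappa> x = \<kappa> x0" "y = x + x0" using x0 by auto
      have "\<chi> i y = 1" if "i \<in> \<Lambda>" for i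
      proof -
        have "\<chi> i x = 1 \<longleftrightarrow> \<chi> i x0 = 1" using x(2) that by (auto simp: \<kappa>_def)
        then show ?thesis using \<chi>_pm[of i x] \<chi>_pm[of i x0] by (auto simp: x(3) \<chi>_add)
      qed
      then show "y \<in> W" using x x0 subgrpD(3)[OF V] by (simp add: W_def)
    qed
    have "card {x \<in> V. \<kappa> x = Y} = card ((\<lambda>x. x + x0) ` {x \<in> V. \<kappa> x = Y})"
      by (rule card_image[symmetric]) (simp add: inj_on_def)
    also have "\<dots> \<le> card W" by (rule card_mono[OF _ sub]) (simp add: W_def finV)
    finally show ?thesis .
  next
    case True
    then show ?thesis by (simp only: card.empty le0)
  qed
  have "\<kappa> x \<in> Pow \<Lambda>" for x by (auto simp: \<kappa>_def)
  then have "V = (\<Union>Y\<in>Pow \<Lambda>. {x \<in> V. \<kappa> x = Y})" by blast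
  then have "card V = card (\<Union>Y\<in>Pow \<Lambda>. {x \<in> V. \<kappa> x = Y})" by simp
  also have "\<dots> \<le> (\<Sum>Y\<in>Pow \<Lambda>. card {x \<in> V. \<kappa> x = Y})" by (rule card_UN_le) (simp add: \<Lambda>)
  also have "\<dots> \<le> (\<Sum>Y\<in>Pow \<Lambda>. card W)" by (intro sum_mono fib)
  also have "\<dots> = 2 ^ card \<Lambda> * card W" by (simp add: card_Pow \<Lambda>)
  finally show ?thesis unfolding W_def .
qed

text \<open>\<open>W\<close> is the common kernel of a maximal dissociated subset \<Lambda> of the
  large spectrum, whose size Chang's bound controls. By maximality any other large character enters
  a relation with members of \<Lambda>, hence is trivial on \<open>W\<close>.\<close>

lemma spectrum_annihilator:
  assumes V: "subgrp V" and T: "T \<subseteq> V" "T \<noteq> {}"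
    and d: "real (card V) \<le> real (card T) * exp (real d / 16)"
  shows "\<exists>W\<subseteq>V. subgrp W \<and> card V \<le> 2 ^ d * card W \<and>
    (\<forall>i\<in>I. real (card T) / 2 \<le> \<bar>hat T i\<bar> \<longrightarrow> (\<forall>x\<in>W. \<chi> i x = 1))"
proof -
  define \<Gamma> where "\<Gamma> = {i \<in> I. real (card T) / 2 \<le> \<bar>hat T i\<bar>}"
  define Q where "Q \<Lambda> \<longleftrightarrow> \<Lambda> \<subseteq> \<Gamma> \<and> dissociated V \<Lambda>" for \<Lambda>
  have fin\<Gamma>: "finite \<Gamma>" using finite_I by (simp add: \<Gamma>_def)
  have "finite {\<Lambda>. Q \<Lambda>}" by (rule finite_subset[of _ "Pow \<Gamma>"]) (auto simp: Q_def fin\<Gamma>)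
  moreover have "{} \<in> {\<Lambda>. Q \<Lambda>}" by (simp add: Q_def dissociated_def)
  ultimately obtain \<Lambda> where \<Lambda>: "Q \<Lambda>" and max: "\<And>\<Lambda>'. Q \<Lambda>' \<Longrightarrow> \<Lambda> \<subseteq> \<Lambda>' \<Longrightarrow> \<Lambda>' = \<Lambda>"
    using finite_has_maximal[of "{\<Lambda>. Q \<Lambda>}"] by auto
  have fin\<Lambda>: "finite \<Lambda>" using \<Lambda> fin\<Gamma> finite_subset by (auto simp: Q_def)
  define W where "W = {x \<in> V. \<forall>i\<in>\<Lambda>. \<chi> i x = 1}"
  have "card \<Lambda> \<le> d"
    by (rule dissociated_card_le[OF V T fin\<Lambda> _ _ d]) (use \<Lambda> in \<open>auto simp: Q_def \<Gamma>_def\<close>)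
  then have "(2::nat) ^ card \<Lambda> \<le> 2 ^ d" by (intro power_increasing) auto
  then have "2 ^ card \<Lambda> * card W \<le> 2 ^ d * card W" by (rule mult_right_mono) simp
  moreover have "card V \<le> 2 ^ card \<Lambda> * card W"
    unfolding W_def by (rule common_kernel_card[OF V fin\<Lambda>])
  ultimately have 1: "card V \<le> 2 ^ d * card W" by (rule order_trans[rotated])
  have 2: "subgrp W"
    using V by (auto simp: subgrp_def W_def \<chi>_add)
  have 3: "\<chi> i x = 1" if i: "i \<in> \<Gamma>" and x: "x \<in> W" for i x
  proof (cases "i \<in> \<Lambda>")
    case False
    then have "\<not> Q (insert i \<Lambda>)" using max[of "insert i \<Lambda>"] by blast
    then have "\<not> dissociated V (insert i \<Lambda>)" using i \<Lambda> by (simp add: Q_def)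
    then obtain X where X: "X \<subseteq> insert i \<Lambda>" "X \<noteq> {}" "\<forall>x\<in>V. (\<Prod>j\<in>X. \<chi> j x) = 1"
      unfolding dissociated_def by metis
    have iX: "i \<in> X"
    proof (rule ccontr)
      assume "i \<notin> X"
      then have "X \<subseteq> \<Lambda>" using X(1) by blast
      moreover have "dissociated V \<Lambda>" using \<Lambda> by (simp add: Q_def)
      ultimately show False using X(2,3) unfolding dissociated_def by blast
    qed
    have finX: "finite X" using X(1) fin\<Lambda> finite_subset by blast
    have "(\<Prod>j\<in>X - {i}. \<chi> j x) = 1" using X(1) x by (intro prod.neutral) (auto simp: W_def)
    then have "(\<Prod>j\<in>X. \<chi> j x) = \<chi> i x" using prod.remove[OF finX iX, of "\<lambda>j. \<chi> j x"] by simp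
    then show ?thesis using X(3) x by (simp add: W_def)
  qed (use x in \<open>simp add: W_def\<close>)
  have "W \<subseteq> V" unfolding W_def by blast
  moreover have "\<forall>i\<in>I. real (card T) / 2 \<le> \<bar>hat T i\<bar> \<longrightarrow> (\<forall>x\<in>W. \<chi> i x = 1)"
    using 3 unfolding \<Gamma>_def by blast
  ultimately show ?thesis using 1 2 by blast
qed

section \<open>From Fourier mass on the large spectrum to a density increment\<close>

text \<open>The transform of \<open>W\<close> is nonnegative everywhere and equals
  \<open>card W\<close> on \<Gamma>, so the mass bounds from below the number of pairs in
  \<open>A\<close> whose sum lies in \<open>W\<close>. Averaging over the first element of the pair
  gives a dense translate.\<close>

lemma increment_of_fourier_mass:
  assumes V: "subgrp V" and A: "A \<subseteq> V" "A \<noteq> {}" and W: "subgrp W" "W \<subseteq> V"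
    and \<Gamma>: "\<Gamma> \<subseteq> I" "\<And>i x. i \<in> \<Gamma> \<Longrightarrow> x \<in> W \<Longrightarrow> \<chi> i x = 1"
    and mass: "c * (real (card A))\<^sup>2 / real (card V) * real (card I) \<le> (\<Sum>i\<in>\<Gamma>. (hat A i)\<^sup>2)"
  shows "\<exists>x\<in>A. c * real (card A) / real (card V) * real (card W) \<le> real (card {w \<in> W. x + w \<in> A})"
proof -
  have finA: "finite A" using A subgrpD(4)[OF V] finite_subset by blast
  have finW: "finite W" by (rule subgrpD(4)[OF W(1)])
  have "hat W i = (if \<forall>x\<in>W. \<chi> i x = 1 then real (card W) else 0)" for i
    unfolding hat_def by (rule character_sum[OF W(1) \<chi>_pm \<chi>_add])
  then have hatW0: "hat W i \<ge> 0" for i by (metis of_nat_0_le_iff order_refl)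
  have hatW: "hat W i = real (card W)" if "i \<in> \<Gamma>" for i
    using \<Gamma>(2)[OF that] by (simp add: hat_def)
  have "real (card W) * (c * (real (card A))\<^sup>2 / real (card V) * real (card I)) \<le> real (card W) * (\<Sum>i\<in>\<Gamma>. (hat A i)\<^sup>2)"
    by (rule mult_left_mono[OF mass]) simp
  also have "\<dots> = (\<Sum>i\<in>\<Gamma>. (hat A i)\<^sup>2 * hat W i)" by (simp add: hatW sum_distrib_left mult.commute)
  also have "\<dots> \<le> (\<Sum>i\<in>I. (hat A i)\<^sup>2 * hat W i)"
    by (rule sum_mono2) (use \<Gamma> finite_I hatW0 in auto)
  also have "\<dots> = (\<Sum>w\<in>W. \<Sum>i\<in>I. (hat A i)\<^sup>2 * \<chi> i w)"
    unfolding hat_def[of W] by (subst sum.swap) (simp add: sum_distrib_left)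
  also have "\<dots> = (\<Sum>w\<in>W. real (card I) * real (rep A w))"
    by (intro sum.cong refl rep_fourier[symmetric]) (use A W subgrpD(1)[OF V] in auto)
  also have "\<dots> = real (card I) * real (\<Sum>w\<in>W. card {a \<in> A. w + a \<in> A})"
    by (simp add: rep_def sum_distrib_left)
  also have "(\<Sum>w\<in>W. card {a \<in> A. w + a \<in> A}) = (\<Sum>a\<in>A. card {w \<in> W. w + a \<in> A})"
    by (rule sum_card_swap[OF finW finA])
  finally have "real (card I) * (c * real (card A) / real (card V) * real (card W) * real (card A))
      \<le> real (card I) * real (\<Sum>a\<in>A. card {w \<in> W. w + a \<in> A})"
    by (simp add: power2_eq_square mult_ac)
  then have "c * real (card A) / real (card V) * real (card W) * real (card A)
      \<le> (\<Sum>a\<in>A. real (card {w \<in> W. w + a \<in> A}))"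
    using card_I_pos by (simp del: times_divide_eq_left)
  from exists_ge_average[OF finA A(2) this] show ?thesis by (simp add: add.commute)
qed

text \<open>Adding one more period adds one error \<eta> by the triangle inequality and one
  exceptional set, whose size is unchanged by the shift by \<open>u\<close>.\<close>

lemma iterated_periods:
  fixes h :: "'a \<Rightarrow> real"
  assumes V: "subgrp V" and T: "T \<subseteq> V"
    and per: "\<And>t. t \<in> T \<Longrightarrow> real (card {x \<in> V. \<bar>h (x + t) - h x\<bar> > \<eta>}) \<le> \<kappa>"
    and u: "u \<in> V" "real (card {x \<in> V. \<bar>h (x + u) - h x\<bar> > real j * \<eta>}) \<le> real j * \<kappa>" and t: "t \<in> T"
  shows "u + t \<in> V" "real (card {x \<in> V. \<bar>h (x + (u + t)) - h x\<bar> > real (Suc j) * \<eta>}) \<le> real (Suc j) * \<kappa>"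
proof -
  note finV = subgrpD(4)[OF V]
  show "u + t \<in> V" using u t T subgrpD(3)[OF V] by blast
  let ?B = "{x \<in> V. \<bar>h (x + u) - h x\<bar> > real j * \<eta>}"
  let ?C = "{x \<in> V. \<bar>h (x + u + t) - h (x + u)\<bar> > \<eta>}"
  have "{x \<in> V. \<bar>h (x + (u + t)) - h x\<bar> > real (Suc j) * \<eta>} \<subseteq> ?B \<union> ?C"
  proof (rule subsetI, rule ccontr)
    fix x assume x: "x \<in> {x \<in> V. \<bar>h (x + (u + t)) - h x\<bar> > real (Suc j) * \<eta>}" and n: "x \<notin> ?B \<union> ?C"
    have 1: "\<bar>h (x + u) - h x\<bar> \<le> real j * \<eta>" and 2: "\<bar>h (x + u + t) - h (x + u)\<bar> \<le> \<eta>"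
      using x n by auto
    have 3: "real (Suc j) * \<eta> < \<bar>h (x + u + t) - h x\<bar>" using x by (simp add: add.assoc)
    have "real (Suc j) * \<eta> = real j * \<eta> + \<eta>" by (simp add: distrib_right)
    then show False using 1 2 3 by linarith
  qed
  then have "card {x \<in> V. \<bar>h (x + (u + t)) - h x\<bar> > real (Suc j) * \<eta>} \<le> card (?B \<union> ?C)"
    by (rule card_mono[rotated]) (simp add: finV)
  also have "\<dots> \<le> card ?B + card ?C" by (rule card_Un_le)
  also have "card ?C = card {x \<in> V. \<bar>h (x + t) - h x\<bar> > \<eta>}"
    by (rule card_shift[OF V u(1), of "\<lambda>x. \<bar>h (x + t) - h x\<bar> > \<eta>"])
  finally show "real (card {x \<in> V. \<bar>h (x + (u + t)) - h x\<bar> > real (Suc j) * \<eta>}) \<le> real (Suc j) * \<kappa>"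
    using u(2) per[OF t] by (simp add: distrib_right)
qed

text \<open>The shift \<open>t\<close> enters only through \<open>\<chi> i t\<close>, so averaging
  it over \<open>T\<close> multiplies each term by the normalised coefficient of
  \<open>T\<close>.\<close>

lemma sum_rep_shifted_fourier:
  assumes A: "A \<subseteq> G" and D: "D \<subseteq> G" and t: "t \<in> G"
  shows "real (card I) * (\<Sum>x\<in>D. \<Sum>a\<in>D. real (rep A (x + a + t))) = (\<Sum>i\<in>I. (hat A i)\<^sup>2 * (hat D i)\<^sup>2 * \<chi> i t)"
proof -
  have 1: "(\<Sum>x\<in>D. \<Sum>a\<in>D. \<chi> i (x + a + t)) = (hat D i)\<^sup>2 * \<chi> i t" for i
  proof -
    have "(hat D i)\<^sup>2 = (\<Sum>x\<in>D. \<Sum>a\<in>D. \<chi> i x * \<chi> i a)"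
      by (simp add: hat_def power2_eq_square sum_product)
    then show ?thesis by (simp only: \<chi>_add sum_distrib_right)
  qed
  have "real (card I) * (\<Sum>x\<in>D. \<Sum>a\<in>D. real (rep A (x + a + t)))
      = (\<Sum>x\<in>D. \<Sum>a\<in>D. real (card I) * real (rep A (x + a + t)))"
    by (simp only: sum_distrib_left)
  also have "\<dots> = (\<Sum>x\<in>D. \<Sum>a\<in>D. \<Sum>i\<in>I. (hat A i)\<^sup>2 * \<chi> i (x + a + t))"
    by (intro sum.cong refl rep_fourier[OF A]) (use D t add_G in blast)
  also have "\<dots> = (\<Sum>x\<in>D. \<Sum>i\<in>I. \<Sum>a\<in>D. (hat A i)\<^sup>2 * \<chi> i (x + a + t))"
    by (intro sum.cong refl sum.swap)
  also have "\<dots> = (\<Sum>i\<in>I. \<Sum>x\<in>D. \<Sum>a\<in>D. (hat A i)\<^sup>2 * \<chi> i (x + a + t))"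
    by (rule sum.swap)
  also have "\<dots> = (\<Sum>i\<in>I. (hat A i)\<^sup>2 * (hat D i)\<^sup>2 * \<chi> i t)"
    by (intro sum.cong refl) (simp only: 1 sum_distrib_left[symmetric] mult.assoc)
  finally show ?thesis .
qed

lemma abs_hat_le: "\<bar>hat A i\<bar> \<le> real (card A)"
  using sum_abs[of "\<chi> i" A] by (simp add: hat_def)

text \<open>Averaging over \<open>m\<close> periods multiplies the Fourier coefficients by the \<open>m\<close>-th power of those of
  \<open>T\<close>, so that only the large spectrum of \<open>T\<close> contributes.\<close>

lemma spectral_mass:
  fixes S :: "'a set" and m k :: nat
  assumes V: "subgrp V" and A: "A \<subseteq> V" "A \<noteq> {}" and D: "D \<subseteq> V" "D \<noteq> {}" and T: "T \<subseteq> V" "T \<noteq> {}"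
    and m: "m = k + 5" and dense: "card V \<le> 2 ^ k * card A"
    and S: "\<And>x. x \<in> S \<Longrightarrow> 9/8 \<le> real (card V) * real (rep A x) / (real (card A))\<^sup>2"
    and DS: "64 * real (card {z \<in> D \<times> D. fst z + snd z \<notin> S}) \<le> (real (card D))\<^sup>2"
    and per: "\<And>t. t \<in> T \<Longrightarrow>
      real (card {x \<in> V. \<bar>real (card {a \<in> D. x + t + a \<in> S}) / real (card D)
          - real (card {a \<in> D. x + a \<in> S}) / real (card D)\<bar> > 1 / (128 * real m)})
        \<le> real (card D) / (128 * real m)"
  shows "33/32 * (real (card A))\<^sup>2 / real (card V) * real (card I)
    \<le> (\<Sum>i\<in>{i\<in>I. real (card T) / 2 \<le> \<bar>hat T i\<bar>}. (hat A i)\<^sup>2)"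
proof -
  note finV = subgrpD(4)[OF V]
  have finA: "finite A" and finD: "finite D" and finT: "finite T"
    using A D T finV finite_subset by blast+
  have cA: "real (card A) > 0" and cD: "real (card D) > 0" and cT: "real (card T) > 0"
    using A D T finA finD finT by (simp_all add: card_gt_0_iff)
  have cV: "real (card V) > 0" using subgrpD(6)[OF V] by simp
  have m0: "real m > 0" by (simp add: m)
  define \<beta> where "\<beta> = (real (card A))\<^sup>2 / real (card V)"
  have \<beta>: "\<beta> > 0" using cA cV by (simp add: \<beta>_def)
  define h where "h x = real (card {a \<in> D. x + a \<in> S}) / real (card D)" for x
  define \<eta> where "\<eta> = 1 / (128 * real m)"
  define \<kappa> where "\<kappa> = real (card D) / (128 * real m)"
  \<comment> \<open>\<open>P j\<close> holds of sums of \<open>j\<close> periods. The values of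
    \<eta> and \<kappa> are scaled so that after \<open>m\<close> periods the total losses are 1/128
    and \<open>card D / 128\<close>.\<close>
  define P where "P j t \<longleftrightarrow> t \<in> V \<and> real (card {x \<in> V. \<bar>h (x + t) - h x\<bar> > real j * \<eta>}) \<le> real j * \<kappa>" for j t
  have per': "real (card {x \<in> V. \<bar>h (x + t) - h x\<bar> > \<eta>}) \<le> \<kappa>" if "t \<in> T" for t
    using per[OF that] by (simp add: h_def \<eta>_def \<kappa>_def)
  have P0: "P 0 0" using subgrpD(2)[OF V] by (simp add: P_def)
  have PS: "P (Suc j) (u + t)" if "P j u" "t \<in> T" for j u t
    using iterated_periods[OF V T(1) per', of u j t] that by (simp add: P_def)
  have h01: "0 \<le> h x" "h x \<le> 1" for x
    using cD card_mono[of D "{a \<in> D. x + a \<in> S}"] finD by (auto simp: h_def divide_le_eq_1)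
  have rep_ge: "9/8 * \<beta> * (if y \<in> S then 1 else 0) \<le> real (rep A y)" for y
    using S[of y] cA cV by (auto simp: \<beta>_def field_simps)
  have sum_h: "(\<Sum>a\<in>D. if x + a \<in> S then 1 else 0) = real (card D) * h x" for x
    using cD by (simp add: h_def sum_if_card[OF finD])
  have hD: "63/64 * real (card D) \<le> (\<Sum>x\<in>D. h x)"
  proof -
    have "real (card D) * (\<Sum>x\<in>D. h x) = (\<Sum>x\<in>D. \<Sum>a\<in>D. if x + a \<in> S then 1 else 0)"
      by (simp only: sum_distrib_left sum_h)
    also have "\<dots> = (\<Sum>z\<in>D \<times> D. if fst z + snd z \<in> S then 1 else 0)"
      by (simp add: sum.cartesian_product case_prod_unfold)
    also have "\<dots> = (\<Sum>z\<in>D \<times> D. 1 - (if fst z + snd z \<notin> S then 1 else 0))"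
      by (intro sum.cong refl) simp
    also have "\<dots> = (real (card D))\<^sup>2 - (\<Sum>z\<in>D \<times> D. if fst z + snd z \<notin> S then 1 else 0)"
      by (simp only: sum_subtractf) (simp add: card_cartesian_product power2_eq_square)
    also have "(\<Sum>z\<in>D \<times> D. if fst z + snd z \<notin> S then 1 else 0) = real (card {z \<in> D \<times> D. fst z + snd z \<notin> S})"
      by (subst sum_if_card) (simp_all add: finD)
    finally have "real (card D) * (63/64 * real (card D)) \<le> real (card D) * (\<Sum>x\<in>D. h x)"
      using DS by (simp add: power2_eq_square)
    then show ?thesis using cD by simp
  qed
  define \<Phi> where "\<Phi> t = (\<Sum>x\<in>D. \<Sum>a\<in>D. real (rep A (x + a + t)))" for t
  have \<Phi>_ge: "17/16 * \<beta> * (real (card D))\<^sup>2 \<le> \<Phi> t" if Pt: "P m t" for t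
  proof -
    let ?B = "{x \<in> V. \<bar>h (x + t) - h x\<bar> > real m * \<eta>}"
    have m\<eta>: "real m * \<eta> = 1/128" and m\<kappa>: "real m * \<kappa> = real (card D) / 128"
      using m0 by (simp_all add: \<eta>_def \<kappa>_def)
    have "h x - 1/128 - (if x \<in> ?B then 1 else 0) \<le> h (x + t)" if "x \<in> D" for x
    proof (cases "x \<in> ?B")
      case True
      then show ?thesis using h01[of x] h01[of "x + t"] by simp
    next
      case False
      then have "\<bar>h (x + t) - h x\<bar> \<le> 1/128" using that D m\<eta> by auto
      then show ?thesis unfolding if_not_P[OF False] by linarith
    qed
    then have "(\<Sum>x\<in>D. h x - 1/128 - (if x \<in> ?B then 1 else 0)) \<le> (\<Sum>x\<in>D. h (x + t))" by (rule sum_mono)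
    moreover have "(\<Sum>x\<in>D. h x - 1/128 - (if x \<in> ?B then 1 else 0))
        = (\<Sum>x\<in>D. h x) - real (card D) / 128 - real (card {x \<in> D. x \<in> ?B})"
      by (simp only: sum_subtractf sum_if_card[OF finD]) simp
    moreover have "real (card {x \<in> D. x \<in> ?B}) \<le> real (card D) / 128"
    proof -
      have "card {x \<in> D. x \<in> ?B} \<le> card ?B" by (rule card_mono) (use finV in auto)
      then show ?thesis using Pt m\<kappa> by (simp add: P_def)
    qed
    ultimately have hs: "31/32 * real (card D) \<le> (\<Sum>x\<in>D. h (x + t))" using hD by linarith
    \<comment> \<open>The mean of \<open>h\<close> on \<open>D\<close> is at least 63/64; the shift
      costs 1/128 pointwise and 1/128 on the exceptional set, leaving 31/32, and
      \<open>9/8 * 31/32 > 17/16\<close>.\<close>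
    have "17/16 * \<beta> * (real (card D))\<^sup>2 \<le> 9/8 * \<beta> * (real (card D) * (31/32 * real (card D)))"
      using \<beta> cD by (simp add: power2_eq_square)
    also have "\<dots> \<le> 9/8 * \<beta> * (real (card D) * (\<Sum>x\<in>D. h (x + t)))"
      using \<beta> cD by (intro mult_left_mono hs) auto
    also have "\<dots> = (\<Sum>x\<in>D. \<Sum>a\<in>D. 9/8 * \<beta> * (if x + t + a \<in> S then 1 else 0))"
      by (simp only: sum_distrib_left[symmetric] sum_h)
    also have "\<dots> \<le> (\<Sum>x\<in>D. \<Sum>a\<in>D. real (rep A (x + t + a)))"
      by (intro sum_mono rep_ge)
    also have "\<dots> = \<Phi> t" by (simp add: \<Phi>_def add_ac)
    finally show ?thesis .
  qed
  define \<tau> where "\<tau> i = hat T i / real (card T)" for i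
  define c where "c i = (hat A i)\<^sup>2 * (hat D i)\<^sup>2" for i
  define L where "L = real (card I) * (17/16 * \<beta> * (real (card D))\<^sup>2)"
  \<comment> \<open>Averaging over one more period gains a factor \<open>\<tau> i\<close>. A shift
    \<open>t\<close> that has used \<open>m - j\<close> periods leaves room for \<open>j\<close>
    more before \<open>\<Phi>_ge\<close> is applied.\<close>
  have step: "L \<le> (\<Sum>i\<in>I. c i * \<tau> i ^ j * \<chi> i t)" if "j \<le> m" "P (m - j) t" for j t
    using that
  proof (induction j arbitrary: t)
    case 0
    then have tG: "t \<in> G" using subgrpD(1)[OF V] by (auto simp: P_def)
    have "L \<le> real (card I) * \<Phi> t" unfolding L_def using \<Phi>_ge 0 by (intro mult_left_mono) auto
    also have "\<dots> = (\<Sum>i\<in>I. c i * \<chi> i t)"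
      unfolding \<Phi>_def c_def by (rule sum_rep_shifted_fourier) (use A D tG subgrpD(1)[OF V] in auto)
    finally show ?case by simp
  next
    case (Suc j)
    have mj: "m - j = Suc (m - Suc j)" using Suc.prems by simp
    have "real (card T) * L = (\<Sum>s\<in>T. L)" by simp
    also have "\<dots> \<le> (\<Sum>s\<in>T. \<Sum>i\<in>I. c i * \<tau> i ^ j * \<chi> i (t + s))"
      by (intro sum_mono Suc.IH) (use Suc.prems PS mj in auto)
    also have "\<dots> = (\<Sum>i\<in>I. c i * \<tau> i ^ j * \<chi> i t * hat T i)"
      by (subst sum.swap) (simp only: \<chi>_add hat_def sum_distrib_left mult.assoc)
    also have "\<dots> = real (card T) * (\<Sum>i\<in>I. c i * \<tau> i ^ Suc j * \<chi> i t)"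
      using cT by (simp add: sum_distrib_left \<tau>_def mult_ac)
    finally show ?case using cT by simp
  qed
  have "L \<le> (\<Sum>i\<in>I. c i * \<tau> i ^ m)" using step[of m 0] P0 by simp
  also have "\<dots> \<le> (\<Sum>i\<in>I. (real (card D))\<^sup>2 * (if real (card T) / 2 \<le> \<bar>hat T i\<bar> then (hat A i)\<^sup>2 else 0)
      + (real (card D))\<^sup>2 * (1/2) ^ m * (hat A i)\<^sup>2)"
  proof (rule sum_mono)
    fix i
    have cle: "c i \<le> (real (card D))\<^sup>2 * (hat A i)\<^sup>2"
    proof -
      have "(hat D i)\<^sup>2 \<le> (real (card D))\<^sup>2" using abs_hat_le[of D i] by (simp add: abs_le_square_iff[symmetric])
      then show ?thesis unfolding c_def by (subst mult.commute) (rule mult_right_mono, simp_all)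
    qed
    have c0: "c i \<ge> 0" by (simp add: c_def)
    have \<tau>1: "\<bar>\<tau> i\<bar> \<le> 1" using abs_hat_le[of T i] cT by (simp add: \<tau>_def)
    have "c i * \<tau> i ^ m \<le> c i * \<bar>\<tau> i\<bar> ^ m"
      using c0 by (intro mult_left_mono) (auto simp: power_abs[symmetric])
    also have "\<dots> \<le> (real (card D))\<^sup>2 * (hat A i)\<^sup>2 * \<bar>\<tau> i\<bar> ^ m"
      by (rule mult_right_mono[OF cle]) simp
    finally have 1: "c i * \<tau> i ^ m \<le> (real (card D))\<^sup>2 * (hat A i)\<^sup>2 * \<bar>\<tau> i\<bar> ^ m" .
    show "c i * \<tau> i ^ m \<le> (real (card D))\<^sup>2 * (if real (card T) / 2 \<le> \<bar>hat T i\<bar> then (hat A i)\<^sup>2 else 0)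
        + (real (card D))\<^sup>2 * (1/2) ^ m * (hat A i)\<^sup>2"
    proof (cases "real (card T) / 2 \<le> \<bar>hat T i\<bar>")
      case True
      have "(real (card D))\<^sup>2 * (hat A i)\<^sup>2 * \<bar>\<tau> i\<bar> ^ m \<le> (real (card D))\<^sup>2 * (hat A i)\<^sup>2 * 1"
        using \<tau>1 by (intro mult_left_mono power_le_one) auto
      moreover have "0 \<le> (real (card D))\<^sup>2 * (1/2) ^ m * (hat A i)\<^sup>2" by simp
      ultimately show ?thesis using 1 unfolding if_P[OF True] by linarith
    next
      case False
      then have "\<bar>\<tau> i\<bar> \<le> 1/2" using cT by (simp add: \<tau>_def field_simps)
      then have "(real (card D))\<^sup>2 * (hat A i)\<^sup>2 * \<bar>\<tau> i\<bar> ^ m \<le> (real (card D))\<^sup>2 * (hat A i)\<^sup>2 * (1/2) ^ m"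
        by (intro mult_left_mono power_mono) auto
      then show ?thesis using 1 unfolding if_not_P[OF False] by (simp add: mult_ac)
    qed
  qed
  also have "\<dots> = (real (card D))\<^sup>2 * (\<Sum>i\<in>{i\<in>I. real (card T) / 2 \<le> \<bar>hat T i\<bar>}. (hat A i)\<^sup>2)
      + (real (card D))\<^sup>2 * (1/2) ^ m * (\<Sum>i\<in>I. (hat A i)\<^sup>2)"
    by (simp only: sum.distrib sum_distrib_left[symmetric] sum.inter_filter[OF finite_I])
  also have "(\<Sum>i\<in>I. (hat A i)\<^sup>2) = real (card I) * real (card A)"
    using rep_fourier[of A 0] A subgrpD(1)[OF V] zero_G by (simp add: rep_def subset_trans)
  finally have main: "(real (card D))\<^sup>2 * (17/16 * \<beta> * real (card I))
      \<le> (real (card D))\<^sup>2 * ((\<Sum>i\<in>{i\<in>I. real (card T) / 2 \<le> \<bar>hat T i\<bar>}. (hat A i)\<^sup>2)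
        + (1/2) ^ m * (real (card I) * real (card A)))"
    unfolding L_def by (simp only: distrib_left mult_ac)
  \<comment> \<open>As \<open>A\<close> has density at least \<open>2 ^ (-k)\<close> and
    \<open>m = k + 5\<close>, the small spectrum costs at most a share 1/32, and
    \<open>17/16 - 1/32 = 33/32\<close>.\<close>
  have "(1/2) ^ m * real (card A) \<le> \<beta> / 32"
  proof -
    have "real (card V) \<le> 2 ^ k * real (card A)" using of_nat_mono[OF dense, where 'a = real] by simp
    then have "real (card A) * real (card V) \<le> real (card A) * (2 ^ k * real (card A))" by (intro mult_left_mono) auto
    then show ?thesis using cV by (simp add: m \<beta>_def power_add field_simps power2_eq_square)
  qed
  then have "real (card I) * ((1/2) ^ m * real (card A)) \<le> real (card I) * (\<beta> / 32)" by (rule mult_left_mono) simp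
  moreover have "17/16 * \<beta> * real (card I) \<le> (\<Sum>i\<in>{i\<in>I. real (card T) / 2 \<le> \<bar>hat T i\<bar>}. (hat A i)\<^sup>2)
        + (1/2) ^ m * (real (card I) * real (card A))"
    using main cD by (subst (asm) mult_le_cancel_left_pos) auto
  ultimately have "33/32 * (\<beta> * real (card I)) \<le> (\<Sum>i\<in>{i\<in>I. real (card T) / 2 \<le> \<bar>hat T i\<bar>}. (hat A i)\<^sup>2)"
    by (simp add: mult_ac)
  then show ?thesis by (simp add: \<beta>_def)
qed

end

section \<open>The density increment\<close>

text \<open>A round number above \<open>16 * (56 * 262144 * 36 * 72 + 1)\<close>, the constant that
  the parameters of the increment step produce.\<close>

definition codim_const :: nat where
  "codim_const = 10 ^ 12"

text \<open>The left-hand side is the \<open>d\<close> of \<open>density_increment\<close> written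
  out: \<open>K\<close> is quadratic in \<open>k\<close> and \<open>l\<close> is quartic, so their
  product has degree 6.\<close>

lemma increment_codim_bound:
  fixes k :: nat
  assumes "k \<ge> 1"
  shows "16 * ((5 * (2 * k + 9) * k + 1) * (262144 * (k + 5)\<^sup>2 * (5 * (2 * k + 9) * k + 1 + (k + 5) + 10)) + 1)
    \<le> codim_const * k ^ 6"
proof -
  have sq: "1 \<le> k\<^sup>2" "k \<le> k\<^sup>2" using assms by (simp_all add: power2_eq_square)
  have a: "5 * (2 * k + 9) * k + 1 \<le> 56 * k\<^sup>2"
  proof -
    have "5 * (2 * k + 9) * k + 1 = 10 * k\<^sup>2 + 45 * k + 1" by (simp add: power2_eq_square algebra_simps)
    then show ?thesis using sq by linarith
  qed
  have b: "(k + 5)\<^sup>2 \<le> 36 * k\<^sup>2"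
    using assms power_mono[of "k + 5" "6 * k" 2] by (simp add: power_mult_distrib)
  have c: "5 * (2 * k + 9) * k + 1 + (k + 5) + 10 \<le> 72 * k\<^sup>2" using a sq by linarith
  have "(5 * (2 * k + 9) * k + 1) * (262144 * (k + 5)\<^sup>2 * (5 * (2 * k + 9) * k + 1 + (k + 5) + 10)) + 1
      \<le> (56 * k\<^sup>2) * (262144 * (36 * k\<^sup>2) * (72 * k\<^sup>2)) + k ^ 6"
    using assms by (intro add_mono mult_mono a b c order_refl) auto
  also have "\<dots> = (56 * (262144 * 36 * 72)) * (k\<^sup>2 * k\<^sup>2 * k\<^sup>2) + k ^ 6"
    by (simp only: mult_ac)
  also have "k\<^sup>2 * k\<^sup>2 * k\<^sup>2 = k ^ 6" by (simp add: power_add[symmetric])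
  finally show ?thesis by (simp add: codim_const_def)
qed

context binary_dual
begin

lemma density_increment:
  assumes V: "subgrp V" and A: "A \<subseteq> V" "A \<noteq> {}" and k: "k \<ge> 1"
    and dense: "card V \<le> 2 ^ k * card A" and gaps: "card V \<le> 2 ^ k * card {x \<in> V. rep A x = 0}"
  shows "\<exists>W\<subseteq>V. subgrp W \<and> card V \<le> 2 ^ (codim_const * k ^ 6) * card W \<and>
    (\<exists>x\<in>A. 33/32 * real (card A) / real (card V) * real (card W) \<le> real (card {w \<in> W. x + w \<in> A}))"
proof -
  note finV = subgrpD(4)[OF V]
  have finA: "finite A" using A finV finite_subset by blast
  have cV: "real (card V) > 0" using subgrpD(6)[OF V] by simp
  have cA: "real (card A) > 0" using A finA by (simp add: card_gt_0_iff)
  \<comment> \<open>\<open>q\<close> is odd, at least \<open>k\<close>, and large enough that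
    \<open>2 ^ q - 1 \<ge> 256\<close>. The density of \<open>D\<close> will be at least
    \<open>2 ^ (-K)\<close>; the summand 1 in \<open>K\<close> pays for the factor 2 lost in
    sifting.\<close>
  define q where "q = 2 * k + 9"
  define p where "p = 5 * q"
  define K where "K = p * k + 1"
  define m where "m = k + 5"
  \<comment> \<open>The error \<open>2 * \<eta>\<close> is the one that \<open>spectral_mass\<close>
    tolerates, and \<open>l\<close> makes \<open>l * \<eta>\<^sup>2 / 4\<close> equal to
    \<open>K + m + 10\<close>: \<open>K\<close> absorbs the density of \<open>D\<close>,
    \<open>m\<close> the denominator \<open>m\<close>, and 10 the factor
    \<open>8 * 128\<close>.\<close>
  define \<eta> where "\<eta> = 1 / (256 * real m)"
  define l where "l = 262144 * m\<^sup>2 * (K + m + 10)"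
  define d where "d = 16 * (K * l + 1)"
  define f where "f x = real (card V) * real (rep A x) / (real (card A))\<^sup>2" for x
  have m0: "real m > 0" by (simp add: m_def)
  have dens: "real (card V) \<le> 2 ^ k * real (card A)"
    using of_nat_mono[OF dense, where 'a = real] by simp
  have "256 * (9/8) ^ p * real (card V) \<le> (\<Sum>x\<in>V. f x ^ p)"
  proof -
    have "real (card V) \<le> 2 ^ k * real (card {x \<in> V. rep A x = 0})"
      using of_nat_mono[OF gaps, where 'a = real] by simp
    also have "\<dots> \<le> 2 ^ q * real (card {x \<in> V. rep A x = 0})"
      by (intro mult_right_mono power_increasing) (auto simp: q_def)
    finally have Z: "real (card V) \<le> 2 ^ q * real (card {x \<in> V. rep A x = 0})" .
    have "(2::real) ^ 9 \<le> 2 ^ q" by (intro power_increasing) (auto simp: q_def)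
    then have "256 \<le> (2::real) ^ q - 1" by simp
    then have "real (card V) * (9/8) ^ p * 256 \<le> real (card V) * (9/8) ^ p * (2 ^ q - 1)"
      by (rule mult_left_mono) simp
    also have "\<dots> \<le> (\<Sum>x\<in>V. f x ^ p)"
      using rep_moment_large[OF V A _ Z] by (simp add: f_def p_def q_def)
    finally show ?thesis by (simp add: mult_ac)
  qed
  then obtain D where D: "D \<subseteq> V" "D \<noteq> {}"
    and D_dense: "(real (card A) / real (card V)) ^ p \<le> 2 * (real (card D) / real (card V))"
    and D_sums: "64 * real (card {z \<in> D \<times> D. f (fst z + snd z) < 9/8}) \<le> (real (card D))\<^sup>2"
    using sifting[OF V A, of p] unfolding f_def by blast
  have finD: "finite D" using D finV finite_subset by blast
  have cD: "real (card D) > 0" using D finD by (simp add: card_gt_0_iff)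
  have DK: "real (card V) \<le> 2 ^ K * real (card D)"
  proof -
    have "(1 / 2 ^ k) \<le> real (card A) / real (card V)" using dens cV by (simp add: field_simps)
    then have "(1 / 2 ^ k) ^ p \<le> (real (card A) / real (card V)) ^ p" by (rule power_mono) simp
    then have "(1 / 2 ^ k) ^ p \<le> 2 * (real (card D) / real (card V))" using D_dense by linarith
    then have "1 / 2 ^ (p * k) \<le> 2 * (real (card D) / real (card V))"
      by (simp add: power_one_over power_mult[symmetric] mult.commute)
    then show ?thesis using cV by (simp add: K_def field_simps)
  qed
  define S where "S = {x. 9/8 \<le> f x}"
  define h where "h x = real (card {a \<in> D. x + a \<in> S}) / real (card D)" for x
  have \<eta>: "0 < \<eta>" "\<eta> \<le> 1" by (auto simp: \<eta>_def m_def field_simps)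
  have l0: "l > 0" by (simp add: l_def m_def)
  obtain T where T: "T \<subseteq> V" "T \<noteq> {}"
    and T_dense: "(real (card D) / real (card V)) ^ l * real (card V) \<le> 2 * real (card T)"
    and T_per: "\<And>t. t \<in> T \<Longrightarrow> real (card {x \<in> V. \<bar>h (x + t) - h x\<bar> > 2 * \<eta>})
        \<le> 8 * exp (- real l * \<eta>\<^sup>2 / 4) * real (card V)"
    using almost_periods[OF V D \<eta> l0, of S] unfolding h_def by blast
  have small: "8 * exp (- real l * \<eta>\<^sup>2 / 4) * real (card V) \<le> real (card D) / (128 * real m)"
  proof -
    have "- real l * \<eta>\<^sup>2 / 4 = - real (K + m + 10)"
      using m0 by (simp add: l_def \<eta>_def power_divide power_mult_distrib field_simps)
    moreover have "exp (- real (K + m + 10)) \<le> 1 / 2 ^ (K + m + 10)"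
    proof -
      have "(2::real) \<le> exp 1" using exp_ge_add_one_self[of 1] by simp
      then have "(2::real) ^ (K + m + 10) \<le> exp 1 ^ (K + m + 10)" by (rule power_mono) simp
      also have "\<dots> = exp (real (K + m + 10))" by (simp only: exp_of_nat_mult[symmetric] mult_1_right)
      finally show ?thesis by (subst exp_minus) (simp add: field_simps)
    qed
    ultimately have "8 * exp (- real l * \<eta>\<^sup>2 / 4) * real (card V) \<le> 8 * (1 / 2 ^ (K + m + 10)) * (2 ^ K * real (card D))"
      using DK by (intro mult_mono) auto
    also have "\<dots> = real (card D) / (128 * 2 ^ m)" by (simp add: power_add)
    also have "\<dots> \<le> real (card D) / (128 * real m)"
    proof -
      have "real m \<le> 2 ^ m" using of_nat_less_two_power[of m] by (simp add: less_imp_le)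
      then show ?thesis using m0 by (intro divide_left_mono) auto
    qed
    finally show ?thesis .
  qed
  have two\<eta>: "2 * \<eta> = 1 / (128 * real m)" by (simp add: \<eta>_def)
  have mass: "33/32 * (real (card A))\<^sup>2 / real (card V) * real (card I)
    \<le> (\<Sum>i\<in>{i\<in>I. real (card T) / 2 \<le> \<bar>hat T i\<bar>}. (hat A i)\<^sup>2)"
  proof (rule spectral_mass[OF V A D T m_def dense])
    show "9/8 \<le> real (card V) * real (rep A x) / (real (card A))\<^sup>2" if "x \<in> S" for x
      using that by (simp add: S_def f_def)
    show "64 * real (card {z \<in> D \<times> D. fst z + snd z \<notin> S}) \<le> (real (card D))\<^sup>2"
      using D_sums by (simp add: S_def not_le)
    fix t assume t: "t \<in> T"
    show "real (card {x \<in> V. \<bar>real (card {a \<in> D. x + t + a \<in> S}) / real (card D)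
          - real (card {a \<in> D. x + a \<in> S}) / real (card D)\<bar> > 1 / (128 * real m)})
        \<le> real (card D) / (128 * real m)"
      using order_trans[OF T_per[OF t] small] unfolding h_def two\<eta> .
  qed
  have "real (card V) \<le> real (card T) * exp (real d / 16)"
  proof -
    have "(1 / 2 ^ K) \<le> real (card D) / real (card V)" using DK cV by (simp add: field_simps)
    then have "(1 / 2 ^ K) ^ l \<le> (real (card D) / real (card V)) ^ l" by (rule power_mono) simp
    then have "(1 / 2 ^ K) ^ l * real (card V) \<le> (real (card D) / real (card V)) ^ l * real (card V)"
      by (rule mult_right_mono) simp
    also note T_dense
    finally have "real (card V) \<le> 2 ^ (K * l + 1) * real (card T)"
      by (simp add: power_one_over power_mult[symmetric] field_simps)
    also have "\<dots> \<le> exp (real (K * l + 1)) * real (card T)"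
    proof (rule mult_right_mono)
      have "(2::real) \<le> exp 1" using exp_ge_add_one_self[of 1] by simp
      then have "(2::real) ^ (K * l + 1) \<le> exp 1 ^ (K * l + 1)" by (rule power_mono) simp
      also have "\<dots> = exp (real (K * l + 1))" by (simp only: exp_of_nat_mult[symmetric] mult_1_right)
      finally show "(2::real) ^ (K * l + 1) \<le> exp (real (K * l + 1))" .
    qed simp
    also have "real (K * l + 1) = real d / 16" by (simp add: d_def)
    finally show ?thesis by (simp only: mult.commute)
  qed
  from spectrum_annihilator[OF V T this] obtain W where W: "W \<subseteq> V" "subgrp W"
    and Wd: "card V \<le> 2 ^ d * card W"
    and ann: "\<And>i x. i \<in> I \<Longrightarrow> real (card T) / 2 \<le> \<bar>hat T i\<bar> \<Longrightarrow> x \<in> W \<Longrightarrow> \<chi> i x = 1" by blast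
  have "d \<le> codim_const * k ^ 6"
    using increment_codim_bound[OF k] unfolding d_def l_def K_def p_def q_def m_def .
  then have "(2::nat) ^ d \<le> 2 ^ (codim_const * k ^ 6)" by (intro power_increasing) auto
  then have "2 ^ d * card W \<le> 2 ^ (codim_const * k ^ 6) * card W" by (rule mult_right_mono) simp
  with Wd have Wk: "card V \<le> 2 ^ (codim_const * k ^ 6) * card W" by (rule order_trans)
  have "\<exists>x\<in>A. 33/32 * real (card A) / real (card V) * real (card W) \<le> real (card {w \<in> W. x + w \<in> A})"
    by (rule increment_of_fourier_mass[OF V A W(2,1) _ _ mass]) (use ann in auto)
  with W Wk show ?thesis by blast
qed

section \<open>Greedy choice of subgroups and iteration of the increment\<close>

text \<open>Greedy doubling: \<open>W\<close> may be enlarged by the coset \<open>W + v\<close> as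
  soon as \<open>v\<close> lies outside \<open>W\<close> and outside
  \<open>W + (B \<inter> V)\<close>, and these together cover fewer than \<open>card V\<close>
  points.\<close>

lemma avoiding_subgroup:
  assumes V: "subgrp V" and B: "0 \<notin> B" and c: "(card (B \<inter> V) + 1) * 2 ^ j \<le> card V"
  shows "\<exists>W\<subseteq>V. subgrp W \<and> card W = 2 ^ j \<and> W \<inter> B = {}"
  using c
proof (induction j)
  case 0
  show ?case
    by (rule exI[of _ "{0}"]) (use B subgrpD(2)[OF V] zero_G in \<open>auto simp: subgrp_def\<close>)
next
  case (Suc j)
  note finV = subgrpD(4)[OF V]
  have "(card (B \<inter> V) + 1) * 2 ^ j \<le> (card (B \<inter> V) + 1) * 2 ^ Suc j" by simp
  then obtain W where W: "W \<subseteq> V" "subgrp W" "card W = 2 ^ j" "W \<inter> B = {}"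
    using Suc le_trans by blast
  have finW: "finite W" by (rule subgrpD(4)[OF W(2)])
  let ?X = "(\<lambda>z. fst z + snd z) ` (W \<times> (B \<inter> V))"
  have "card (W \<union> ?X) \<le> card W + card ?X" by (rule card_Un_le)
  also have "card ?X \<le> card (W \<times> (B \<inter> V))" by (rule card_image_le) (simp add: finW finV)
  also have "card W + card (W \<times> (B \<inter> V)) = 2 ^ j * (card (B \<inter> V) + 1)"
    by (simp add: card_cartesian_product W(3))
  also have "\<dots> < (card (B \<inter> V) + 1) * 2 ^ Suc j" by simp
  also note Suc.prems
  finally have lt: "card (W \<union> ?X) < card V" by simp
  have "\<not> V \<subseteq> W \<union> ?X"
  proof
    assume "V \<subseteq> W \<union> ?X"
    then have "card V \<le> card (W \<union> ?X)" by (rule card_mono[rotated]) (simp add: finW finV)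
    then show False using lt by simp
  qed
  then obtain v where v: "v \<in> V" "v \<notin> W" "v \<notin> ?X" by blast
  let ?Y = "(\<lambda>w. w + v) ` W"
  have cl: "w + w' \<in> W" if "w \<in> W" "w' \<in> W" for w w' using subgrpD(3)[OF W(2)] that .
  have disj: "W \<inter> ?Y = {}"
  proof (rule ccontr)
    assume "W \<inter> ?Y \<noteq> {}"
    then obtain w where w: "w \<in> W" "w + v \<in> W" by auto
    then have "w + (w + v) \<in> W" by (rule cl)
    then show False using v by simp
  qed
  have sub: "W \<union> ?Y \<subseteq> V" using W v subgrpD(3)[OF V] by auto
  have "subgrp (W \<union> ?Y)"
    unfolding subgrp_def
  proof (intro conjI ballI)
    show "W \<union> ?Y \<subseteq> G" using sub subgrpD(1)[OF V] by blast
    show "0 \<in> W \<union> ?Y" using subgrpD(2)[OF W(2)] by blast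
    fix x y assume x: "x \<in> W \<union> ?Y" and y: "y \<in> W \<union> ?Y"
    have 1: "(w + v) + (w' + v) = w + w'" "w + (w' + v) = (w + w') + v" "(w + v) + w' = (w + w') + v" for w w'
    proof -
      have "(w + v) + (w' + v) = (w + w') + (v + v)" by (simp only: add_ac)
      then show "(w + v) + (w' + v) = w + w'" by simp
    qed (simp_all only: add_ac)
    from x y show "x + y \<in> W \<union> ?Y"
      by (elim UnE imageE) (simp_all add: 1 cl)
  qed
  moreover have "card (W \<union> ?Y) = 2 ^ Suc j"
  proof -
    have "card ?Y = card W" by (intro card_image inj_onI) simp
    then show ?thesis using card_Un_disjoint[OF finW _ disj] finW W(3) by simp
  qed
  moreover have "(W \<union> ?Y) \<inter> B = {}"
  proof -
    have "w + v \<notin> B" if w: "w \<in> W" for w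
    proof
      assume b: "w + v \<in> B"
      have "v = fst (w, w + v) + snd (w, w + v)" by simp
      moreover have "w + v \<in> V" using w v W subgrpD(3)[OF V] by blast
      ultimately have "v \<in> ?X" using w b by (intro image_eqI[of _ _ "(w, w + v)"]) auto
      then show False using v by simp
    qed
    then show ?thesis using W(4) by auto
  qed
  ultimately show ?case using sub by blast
qed

lemma sparse_avoiding_subgroup:
  assumes V: "subgrp V" and B: "0 \<notin> B" and c: "2 ^ Suc k * card (B \<inter> V) < card V" "2 ^ Suc k \<le> card V"
  shows "\<exists>W. subgrp W \<and> card W = 2 ^ k \<and> W \<inter> B = {}"
proof -
  have "2 * ((card (B \<inter> V) + 1) * 2 ^ k) \<le> 2 * card V" using c by (simp add: algebra_simps)
  then show ?thesis using avoiding_subgroup[OF V B, of k] by auto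
qed

text \<open>The total number \<open>J\<close> of steps is fixed beforehand so that
  \<open>thick\<close> applies to every subgroup met on the way; each step replaces
  \<open>A'\<close> by a translate of its densest part found on a coset.\<close>

lemma iterated_increment:
  assumes A: "A \<subseteq> G" "A \<noteq> {}" and k: "k \<ge> 1" and dense: "card G \<le> 2 ^ k * card A"
    and AB: "\<And>a a'. a \<in> A \<Longrightarrow> a' \<in> A \<Longrightarrow> a + a' \<notin> B"
    and thick: "\<And>V. subgrp V \<Longrightarrow> card G \<le> 2 ^ (J * (codim_const * k ^ 6)) * card V \<Longrightarrow> card V \<le> 2 ^ k * card (B \<inter> V)"
    and j: "j \<le> J"
  shows "\<exists>V A'. subgrp V \<and> A' \<subseteq> V \<and> A' \<noteq> {} \<and> (\<forall>a\<in>A'. \<forall>a'\<in>A'. a + a' \<notin> B) \<and>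
    card G \<le> 2 ^ (j * (codim_const * k ^ 6)) * card V \<and>
    (33/32) ^ j / 2 ^ k * real (card V) \<le> real (card A')"
  using j
proof (induction j)
  case 0
  have "real (card G) \<le> 2 ^ k * real (card A)"
    using of_nat_mono[OF dense, where 'a = real] by simp
  then have "(33/32) ^ 0 / 2 ^ k * real (card G) \<le> real (card A)" by (simp add: field_simps)
  with A AB subgrp_G show ?case by (intro exI[of _ G] exI[of _ A]) simp
next
  case (Suc j)
  define d where "d = codim_const * k ^ 6"
  obtain V A' where V: "subgrp V" and A': "A' \<subseteq> V" "A' \<noteq> {}" and AB': "\<forall>a\<in>A'. \<forall>a'\<in>A'. a + a' \<notin> B"
    and cV: "card G \<le> 2 ^ (j * d) * card V"
    and cA': "(33/32) ^ j / 2 ^ k * real (card V) \<le> real (card A')"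
    using Suc unfolding d_def by (meson Suc_leD)
  note finV = subgrpD(4)[OF V]
  have V0: "real (card V) > 0" using subgrpD(6)[OF V] by simp
  \<comment> \<open>The density never falls below its initial bound, so the same \<open>k\<close>
    serves in every step.\<close>
  have "real (card V) \<le> (33/32) ^ j * real (card V)"
    using mult_right_mono[of 1 "(33/32::real) ^ j" "real (card V)"] by (simp add: one_le_power)
  also have "\<dots> \<le> 2 ^ k * real (card A')" using cA' by (simp add: field_simps)
  finally have "real (card V) \<le> real (2 ^ k * card A')" by simp
  then have dense': "card V \<le> 2 ^ k * card A'" by (simp only: of_nat_le_iff)
  have "(2::nat) ^ (j * d) \<le> 2 ^ (J * d)" using Suc.prems by (intro power_increasing mult_right_mono) auto
  then have "2 ^ (j * d) * card V \<le> 2 ^ (J * d) * card V" by (rule mult_right_mono) simp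
  with cV have "card G \<le> 2 ^ (J * d) * card V" by (rule order_trans)
  then have "card V \<le> 2 ^ k * card (B \<inter> V)" using thick[OF V] by (simp add: d_def)
  also have "\<dots> \<le> 2 ^ k * card {x \<in> V. rep A' x = 0}"
  proof (intro mult_left_mono card_mono subsetI)
    fix x assume x: "x \<in> B \<inter> V"
    \<comment> \<open>A point of \<open>B\<close> is not a sum of two elements of \<open>A'\<close>,
      so the density of \<open>B\<close> supplies the unrepresented points needed for the
      increment.\<close>
    have empty: "{a \<in> A'. x + a \<in> A'} = {}"
    proof (rule ccontr)
      assume "{a \<in> A'. x + a \<in> A'} \<noteq> {}"
      then obtain a where a: "a \<in> A'" "x + a \<in> A'" by blast
      then have "x + a + a \<notin> B" using AB' by blast
      then show False using x by simp
    qed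
    have "rep A' x = 0" unfolding rep_def empty by simp
    then show "x \<in> {x \<in> V. rep A' x = 0}" using x by simp
  qed (simp_all add: finV)
  finally obtain W x where W: "W \<subseteq> V" "subgrp W" and cW: "card V \<le> 2 ^ d * card W" and x: "x \<in> A'"
    and inc: "33/32 * real (card A') / real (card V) * real (card W) \<le> real (card {w \<in> W. x + w \<in> A'})"
    using density_increment[OF V A' k dense'] unfolding d_def by blast
  define A'' where "A'' = {w \<in> W. x + w \<in> A'}"
  have "(33/32) ^ Suc j / 2 ^ k * real (card W) = 33/32 * ((33/32) ^ j / 2 ^ k * real (card V)) / real (card V) * real (card W)"
    using V0 by simp
  also have "\<dots> \<le> 33/32 * real (card A') / real (card V) * real (card W)"
    by (intro mult_right_mono divide_right_mono mult_left_mono cA') auto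
  also note inc
  finally have 1: "(33/32) ^ Suc j / 2 ^ k * real (card W) \<le> real (card A'')" by (simp only: A''_def)
  have "0 < (33/32) ^ Suc j / 2 ^ k * real (card W)" using subgrpD(6)[OF W(2)] by simp
  then have 2: "A'' \<noteq> {}" using 1 by auto
  have 3: "a + a' \<notin> B" if "a \<in> A''" "a' \<in> A''" for a a'
  proof -
    have "(x + a) + (x + a') \<notin> B" using AB' that by (simp add: A''_def)
    \<comment> \<open>Both summands are translated by \<open>x\<close>, which cancels in exponent
      two, so the sums of \<open>A''\<close> are sums of \<open>A'\<close>.\<close>
    moreover have "(x + a) + (x + a') = (x + x) + (a + a')" by (simp only: add_ac)
    ultimately show ?thesis by simp
  qed
  have "card G \<le> 2 ^ (j * d) * card V" by (rule cV)
  also have "\<dots> \<le> 2 ^ (j * d) * (2 ^ d * card W)" by (rule mult_left_mono[OF cW]) simp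
  finally have 4: "card G \<le> 2 ^ (Suc j * d) * card W" by (simp add: power_add mult_ac)
  have "A'' \<subseteq> W" by (auto simp: A''_def)
  with 1 2 3 4 W(2) show ?case unfolding d_def by blast
qed

text \<open>If \<open>A\<close> is sparse in the whole group, or \<open>B\<close> in some subgroup
  of bounded codimension, the greedy choice applies. Otherwise \<open>23 * Suc k\<close> increments
  would push the density above 1.\<close>

lemma sum_avoiding_subgroup:
  assumes A: "A \<subseteq> G" "0 \<notin> A" and B: "0 \<notin> B"
    and AB: "\<And>a a'. a \<in> A \<Longrightarrow> a' \<in> A \<Longrightarrow> a + a' \<notin> B"
    and big: "2 ^ (23 * codim_const * Suc k ^ 7 + Suc k) \<le> card G"
  shows "\<exists>W. subgrp W \<and> card W = 2 ^ k \<and> (W \<inter> A = {} \<or> W \<inter> B = {})"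
proof (cases "card G \<le> 2 ^ Suc k * card A")
  case False
  have "(2::nat) ^ Suc k \<le> 2 ^ (23 * codim_const * Suc k ^ 7 + Suc k)" by (intro power_increasing) auto
  also note big
  finally have "2 ^ Suc k \<le> card G" .
  moreover have "A \<inter> G = A" using A by blast
  ultimately show ?thesis using sparse_avoiding_subgroup[OF subgrp_G A(2), of k] False by auto
next
  case True
  define d where "d = codim_const * Suc k ^ 6"
  have Ane: "A \<noteq> {}" using True subgrpD(6)[OF subgrp_G] by auto
  have "\<exists>V. subgrp V \<and> card G \<le> 2 ^ (23 * Suc k * d) * card V \<and> 2 ^ Suc k * card (B \<inter> V) < card V"
  proof (rule ccontr)
    assume "\<not> ?thesis"
    then have "card V \<le> 2 ^ Suc k * card (B \<inter> V)" if "subgrp V" "card G \<le> 2 ^ (23 * Suc k * d) * card V" for V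
      using that by (meson not_le)
    then obtain V A' where V: "subgrp V" and A': "A' \<subseteq> V"
      and le: "(33/32) ^ (23 * Suc k) / 2 ^ Suc k * real (card V) \<le> real (card A')"
      using iterated_increment[OF A(1) Ane _ True AB, of "23 * Suc k" "23 * Suc k"] unfolding d_def by auto
    have V0: "real (card V) > 0" using subgrpD(6)[OF V] by simp
    \<comment> \<open>The constant 23 comes from \<open>(33/32) ^ 23 > 2\<close>: each block of 23
      steps doubles the density bound.\<close>
    have "(2::real) ^ Suc k < ((33/32) ^ 23) ^ Suc k" by (rule power_strict_mono) (auto simp: power_divide)
    then have "1 < (33/32::real) ^ (23 * Suc k) / 2 ^ Suc k" by (simp only: power_mult[symmetric]) (simp add: field_simps)
    then have "1 * real (card V) < (33/32) ^ (23 * Suc k) / 2 ^ Suc k * real (card V)"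
      using V0 by (rule mult_strict_right_mono)
    also note le
    also have "real (card A') \<le> real (card V)" using card_mono[OF subgrpD(4)[OF V] A'] by simp
    finally show False by simp
  qed
  then obtain V where V: "subgrp V" "card G \<le> 2 ^ (23 * Suc k * d) * card V" "2 ^ Suc k * card (B \<inter> V) < card V"
    by blast
  have "x ^ 7 = x * x ^ 6" for x :: nat by (simp add: eval_nat_numeral)
  then have "23 * codim_const * Suc k ^ 7 = 23 * Suc k * d" by (simp only: d_def mult_ac)
  then have "2 ^ (23 * Suc k * d) * 2 ^ Suc k \<le> card G" using big by (simp only: power_add)
  also note V(2)
  finally have "2 ^ Suc k \<le> card V" by (rule mult_left_le_imp_le) simp
  then show ?thesis using sparse_avoiding_subgroup[OF V(1) B V(3)] by blast
qed

end

section \<open>Subspaces of the binary projective geometry\<close>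

declare add_bit_eq_xor [simp del] mult_bit_eq_and [simp del]

text \<open>A model of F_2^n by functions with pointwise addition: they form one abelian group for
  all \<open>n\<close>, as \<open>binary_dual\<close> requires, whereas vectors of different
  dimensions share no zero.\<close>

definition bit_fun_space :: "nat \<Rightarrow> (nat \<Rightarrow> bit) set" where
  "bit_fun_space n = {f. \<forall>i\<ge>n. f i = 0}"

text \<open>The character sending \<open>f\<close> to -1 to the power of the sum of \<open>f\<close>
  over \<open>R\<close>.\<close>

definition sign_char :: "nat set \<Rightarrow> (nat \<Rightarrow> bit) \<Rightarrow> real" where
  "sign_char R f = (\<Prod>i\<in>R. if f i = 0 then 1 else - 1)"

lemma bit_cases: "(x::bit) = 0 \<or> x = 1"
  using bit_not_zero_iff by blast

lemma UNIV_bit: "(UNIV :: bit set) = {0, 1}"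
  using bit_cases by auto

lemma bij_betw_bit_fun_space: "bij_betw (\<lambda>f. {i. f i = 1}) (bit_fun_space n) (Pow {..<n})"
proof (rule bij_betwI[where g = "\<lambda>S i. if i \<in> S then 1 else 0"])
  show "(\<lambda>f. {i. f i = 1}) \<in> bit_fun_space n \<rightarrow> Pow {..<n}"
    by (auto simp: bit_fun_space_def not_less[symmetric])
  show "(\<lambda>S i. if i \<in> S then 1 else 0) \<in> Pow {..<n} \<rightarrow> bit_fun_space n"
    by (auto simp: bit_fun_space_def)
qed (use bit_cases in \<open>auto simp: fun_eq_iff\<close>)

lemma card_bit_fun_space: "card (bit_fun_space n) = 2 ^ n"
  using bij_betw_same_card[OF bij_betw_bit_fun_space] by (simp add: card_Pow)

lemma binary_dual_bit_fun_space: "binary_dual (bit_fun_space n) (Pow {..<n}) sign_char"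
proof
  show "f + f = 0" for f :: "nat \<Rightarrow> bit"
    by (auto simp: fun_eq_iff)
  show "finite (bit_fun_space n)"
    using bij_betw_finite[OF bij_betw_bit_fun_space, of n] by simp
  show "0 \<in> bit_fun_space n" by (simp add: bit_fun_space_def)
  show "x + y \<in> bit_fun_space n" if "x \<in> bit_fun_space n" "y \<in> bit_fun_space n" for x y
    using that by (simp add: bit_fun_space_def)
  show "finite (Pow {..<n})" "Pow {..<n} \<noteq> {}" by auto
  show "sign_char R f = 1 \<or> sign_char R f = - 1" for R f
  proof -
    have "\<bar>sign_char R f\<bar> = 1" by (auto simp: sign_char_def abs_prod intro!: prod.neutral)
    then show ?thesis by linarith
  qed
  show "sign_char R (x + y) = sign_char R x * sign_char R y" for R x y
    unfolding sign_char_def prod.distrib[symmetric]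
  proof (rule prod.cong)
    fix i
    show "(if (x + y) i = 0 then 1 else - 1 :: real) = (if x i = 0 then 1 else - 1) * (if y i = 0 then 1 else - 1)"
      using bit_cases[of "x i"] bit_cases[of "y i"] by auto
  qed simp
  fix f assume f: "f \<in> bit_fun_space n"
  \<comment> \<open>The sum over all \<open>R\<close> factors over coordinates, and a coordinate
    with \<open>f i = 1\<close> contributes the factor \<open>-1 + 1 = 0\<close>.\<close>
  have "(\<Sum>R\<in>Pow {..<n}. sign_char R f) = (\<Prod>i<n. (if f i = 0 then 1 else - 1) + 1)"
    by (subst prod_add) (simp_all add: sign_char_def)
  also have "\<dots> = (if f = 0 then real (card (Pow {..<n})) else 0)"
  proof (cases "f = 0")
    case True
    then show ?thesis by (simp add: card_Pow)
  next
    case False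
    then obtain i where "f i \<noteq> 0" by (auto simp: fun_eq_iff)
    then have "i < n" using f by (auto simp: bit_fun_space_def not_less[symmetric])
    then have "(\<Prod>i<n. (if f i = 0 then 1 else - 1) + 1 :: real) = 0"
      using \<open>f i \<noteq> 0\<close> by (intro prod_zero) auto
    then show ?thesis using False by simp
  qed
  finally show "(\<Sum>R\<in>Pow {..<n}. sign_char R f) = (if f = 0 then real (card (Pow {..<n})) else 0)" .
qed

lemma vec_add_fun: "vec n (f + g) = vec n f + vec n g"
  by (intro eq_vecI) auto

lemma inj_on_vec: "inj_on (vec n) (bit_fun_space n)"
proof (rule inj_onI)
  fix f g assume fg: "f \<in> bit_fun_space n" "g \<in> bit_fun_space n" "vec n f = vec n g"
  show "f = g"
  proof
    fix i
    show "f i = g i"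
    proof (cases "i < n")
      case True
      then have "vec n f $ i = vec n g $ i" using fg(3) by simp
      then show ?thesis using True by simp
    qed (use fg in \<open>simp add: bit_fun_space_def\<close>)
  qed
qed

section \<open>Subspaces and their dimensions by counting\<close>

text \<open>The only scalars are 0 and 1, so additive closure already gives closure under scalar
  multiplication.\<close>

lemma F2_subspaceI:
  assumes W: "W \<subseteq> carrier_vec n" "0\<^sub>v n \<in> W" "\<And>x y. x \<in> W \<Longrightarrow> y \<in> W \<Longrightarrow> x + y \<in> W"
  shows "subspace class_ring W (F2_space n)"
proof -
  have "c \<cdot>\<^sub>v v \<in> W" if "v \<in> W" for c and v :: "bit vec"
  proof -
    have "v \<in> carrier_vec n" using that W(1) by blast
    then have "0 \<cdot>\<^sub>v v = 0\<^sub>v n" by (intro eq_vecI) auto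
    then show ?thesis using bit_cases[of c] that W(2) by auto
  qed
  then have "submodule class_ring W (F2_space n)"
    using W vec_module by (intro submodule.intro) (auto simp: module_vec_simps)
  then show ?thesis using vec_vs by (auto simp: subspace_def)
qed

text \<open>Every element is a combination of a basis with coefficients in a two-element field. This
  turns the cardinality of a subgroup into a lower bound for its dimension.\<close>

lemma card_le_power_dim:
  assumes W: "subspace class_ring W (F2_space n)" "finite W"
  shows "card W \<le> 2 ^ vectorspace.dim class_ring (F2_space n \<lparr>carrier := W\<rparr>)"
proof -
  interpret V: vectorspace "class_ring :: bit ring" "F2_space n" by (rule vec_vs)
  interpret U: vectorspace "class_ring :: bit ring" "F2_space n \<lparr>carrier := W\<rparr>"
    by (rule V.subspace_is_vs[OF W(1)])
  have cU: "carrier (F2_space n \<lparr>carrier := W\<rparr>) = W" by simp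
  have "U.span W = W"
    using U.in_own_span[of W] U.span_is_subset2[of W] by auto
  then have "U.fin_dim" using W(2) unfolding U.fin_dim_def by (intro exI[of _ W]) auto
  then obtain \<beta> where \<beta>: "finite \<beta>" "U.basis \<beta>" using U.finite_basis_exists by blast
  have sub: "\<beta> \<subseteq> W" using \<beta>(2) by (simp add: U.basis_def)
  have "W = U.span \<beta>" using \<beta>(2) by (simp add: U.basis_def)
  also have "U.span \<beta> = {U.lincomb a \<beta> | a. a \<in> \<beta> \<rightarrow> carrier (class_ring :: bit ring)}"
    by (rule U.finite_span) (use \<beta>(1) sub in auto)
  also have "\<dots> \<subseteq> (\<lambda>a. U.lincomb a \<beta>) ` (\<beta> \<rightarrow>\<^sub>E UNIV)"
  proof
    fix v assume "v \<in> {U.lincomb a \<beta> | a. a \<in> \<beta> \<rightarrow> carrier (class_ring :: bit ring)}"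
    then obtain a where "v = U.lincomb a \<beta>" by blast
    moreover have "U.lincomb (restrict a \<beta>) \<beta> = U.lincomb a \<beta>"
      by (rule U.lincomb_cong) (use sub in auto)
    ultimately show "v \<in> (\<lambda>a. U.lincomb a \<beta>) ` (\<beta> \<rightarrow>\<^sub>E UNIV)"
      by (intro image_eqI[of _ _ "restrict a \<beta>"]) auto
  qed
  finally have "W \<subseteq> (\<lambda>a. U.lincomb a \<beta>) ` (\<beta> \<rightarrow>\<^sub>E UNIV)" .
  then have "card W \<le> card ((\<lambda>a. U.lincomb a \<beta>) ` (\<beta> \<rightarrow>\<^sub>E (UNIV :: bit set)))"
    using \<beta>(1) by (intro card_mono finite_imageI finite_PiE) (auto simp: UNIV_bit)
  also have "\<dots> \<le> card (\<beta> \<rightarrow>\<^sub>E (UNIV :: bit set))"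
    using \<beta>(1) by (intro card_image_le finite_PiE) (auto simp: UNIV_bit)
  also have "\<dots> = 2 ^ card \<beta>" using \<beta>(1) by (simp add: card_PiE UNIV_bit numeral_2_eq_2)
  also have "card \<beta> = U.dim" using U.dim_basis[OF \<beta>] by simp
  finally show ?thesis .
qed

lemma pg_subspace_of_closed:
  assumes W: "W \<subseteq> carrier_vec n" "0\<^sub>v n \<in> W" "\<And>x y. x \<in> W \<Longrightarrow> y \<in> W \<Longrightarrow> x + y \<in> W"
    and card: "card W = 2 ^ k"
  shows "pg_subspace n (W - {0\<^sub>v n})" "k \<le> pg_dim n (W - {0\<^sub>v n})"
proof -
  have s: "subspace class_ring W (F2_space n)" by (rule F2_subspaceI[OF W])
  then show "pg_subspace n (W - {0\<^sub>v n})" by (auto simp: pg_subspace_def)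
  have "finite W" using card by (metis card.infinite power_not_zero zero_neq_numeral)
  from card_le_power_dim[OF s this] have "(2::nat) ^ k \<le> 2 ^ pg_dim n (W - {0\<^sub>v n})"
    using W(2) by (simp add: card pg_dim_def insert_absorb)
  then show "k \<le> pg_dim n (W - {0\<^sub>v n})" by (simp only: power_increasing_iff one_less_numeral_iff semiring_norm)
qed

section \<open>Embedded copies of \<open>T\<close> and the main result\<close>

text \<open>Two distinct nonzero vectors over F_2 are linearly independent, so sending the unit
  vectors to \<open>f\<close> and \<open>g\<close> is an embedding.\<close>

lemma pg_contains_triangleI:
  assumes f: "f \<in> bit_fun_space n" "f \<noteq> 0" and g: "g \<in> bit_fun_space n" "g \<noteq> 0" "f \<noteq> g"
    and c: "c (vec n f) = c0 (vec_of_list [1, 0])" "c (vec n g) = c0 (vec_of_list [0, 1])"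
      "c (vec n (f + g)) = c0 (vec_of_list [1, 1])"
  shows "pg_contains n c 2 c0"
proof -
  define \<psi> where "\<psi> x = vec n (\<lambda>i. x $ 0 * f i + x $ 1 * g i)" for x :: "bit vec"
  have "linear_map class_ring (F2_space 2) (F2_space n) \<psi>"
    unfolding linear_map_def mod_hom_def mod_hom_axioms_def LinearCombinations.module_hom_def
    by (auto simp: vec_vs vec_module module_vec_simps \<psi>_def distrib_right distrib_left mult.assoc
        add_ac intro!: eq_vecI)
  moreover have "inj_on \<psi> (carrier_vec 2)"
  proof (rule inj_onI)
    fix x y assume x: "x \<in> carrier_vec 2" and y: "y \<in> carrier_vec 2" and eq: "\<psi> x = \<psi> y"
    have e: "x $ 0 * f i + x $ 1 * g i = y $ 0 * f i + y $ 1 * g i" for i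
    proof (cases "i < n")
      case True
      then show ?thesis using arg_cong[OF eq, of "\<lambda>v. v $ i"] by (simp add: \<psi>_def)
    qed (use f g in \<open>simp add: bit_fun_space_def\<close>)
    \<comment> \<open>The coordinates of the difference of \<open>x\<close> and \<open>y\<close>,
      since subtraction of bits is addition.\<close>
    define p q where "p = x $ 0 + y $ 0" and "q = x $ 1 + y $ 1"
    have z: "p * f i + q * g i = 0" for i
      using e[of i] bit_cases[of "x $ 0"] bit_cases[of "x $ 1"] bit_cases[of "y $ 0"] bit_cases[of "y $ 1"]
        bit_cases[of "f i"] bit_cases[of "g i"] by (auto simp: p_def q_def)
    have "p = 0 \<and> q = 0"
    proof (rule ccontr)
      assume "\<not> (p = 0 \<and> q = 0)"
      then consider "p = 1" "q = 0" | "p = 0" "q = 1" | "p = 1" "q = 1" using bit_cases by blast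
      then show False
      proof cases
        case 1
        then have "f = 0" using z by (auto simp: fun_eq_iff)
        then show ?thesis using f by simp
      next
        case 2
        then have "g = 0" using z by (auto simp: fun_eq_iff)
        then show ?thesis using g by simp
      next
        case 3
        have "f i = g i" for i using z[of i] 3 bit_cases[of "f i"] bit_cases[of "g i"] by auto
        then show ?thesis using g by (auto simp: fun_eq_iff)
      qed
    qed
    then have "x $ 0 = y $ 0" "x $ 1 = y $ 1"
      using bit_cases[of "x $ 0"] bit_cases[of "x $ 1"] bit_cases[of "y $ 0"] bit_cases[of "y $ 1"]
      by (auto simp: p_def q_def)
    then show "x = y" using x y by (intro eq_vecI) (auto simp: less_2_cases_iff)
  qed
  moreover have "c (\<psi> x) = c0 x" if x: "x \<in> pg_points 2" for x
  proof -
    have x2: "x \<in> carrier_vec 2" "x \<noteq> 0\<^sub>v 2" using x by (auto simp: pg_points_def)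
    have eq: "x = vec_of_list [x $ 0, x $ 1]"
      using x2(1) by (intro eq_vecI) (auto simp: less_Suc_eq numeral_2_eq_2)
    have "\<not> (x $ 0 = 0 \<and> x $ 1 = 0)"
    proof
      assume "x $ 0 = 0 \<and> x $ 1 = 0"
      then have "x = 0\<^sub>v 2" using x2(1) by (intro eq_vecI) (auto simp: less_2_cases_iff)
      then show False using x2 by simp
    qed
    then consider "x $ 0 = 1" "x $ 1 = 0" | "x $ 0 = 0" "x $ 1 = 1" | "x $ 0 = 1" "x $ 1 = 1"
      using bit_cases by blast
    then show ?thesis
    proof cases
      case 1
      then have "\<psi> x = vec n f" "x = vec_of_list [1, 0]" using eq by (auto simp: \<psi>_def)
      then show ?thesis using c by simp
    next
      case 2
      then have "\<psi> x = vec n g" "x = vec_of_list [0, 1]" using eq by (auto simp: \<psi>_def)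
      then show ?thesis using c by simp
    next
      case 3
      then have "\<psi> x = vec n (f + g)" "x = vec_of_list [1, 1]"
        using eq by (auto simp: \<psi>_def plus_fun_def)
      then show ?thesis using c by simp
    qed
  qed
  ultimately show ?thesis unfolding pg_contains_def by blast
qed

text \<open>Three points in at most two colours leave a pair of equal colour. The linear
  automorphisms of \<open>T\<close> permute its points arbitrarily, so it does not matter which pair
  it is.\<close>

lemma monochromatic_pair:
  assumes s: "s0 \<in> {1, 2}" "s0 \<le> s" and c0: "pg_colouring s0 2 c0"
  shows "\<exists>a\<in>{1..s}. \<exists>b\<in>{1..s}. \<forall>n c f g. pg_free n c 2 c0 \<longrightarrow> f \<in> bit_fun_space n \<longrightarrow> g \<in> bit_fun_space n \<longrightarrow>
    f \<noteq> 0 \<longrightarrow> g \<noteq> 0 \<longrightarrow> f \<noteq> g \<longrightarrow> c (vec n f) = a \<longrightarrow> c (vec n g) = a \<longrightarrow> c (vec n (f + g)) \<noteq> b"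
proof -
  define u w t :: "bit vec" where "u = vec_of_list [1, 0]" and "w = vec_of_list [0, 1]" and "t = vec_of_list [1, 1]"
  have car: "u \<in> carrier_vec 2" "w \<in> carrier_vec 2" "t \<in> carrier_vec 2"
    by (simp_all add: u_def w_def t_def carrier_dim_vec)
  have "u $ 0 = 1" "w $ 1 = 1" "t $ 0 = 1" by (auto simp: u_def w_def t_def)
  then have "u \<in> pg_points 2" "w \<in> pg_points 2" "t \<in> pg_points 2"
    using car by (auto simp: pg_points_def)
  then have range: "c0 u \<in> {1..s0}" "c0 w \<in> {1..s0}" "c0 t \<in> {1..s0}"
    using c0 by (auto simp: pg_colouring_def)
  then have rs: "c0 u \<in> {1..s}" "c0 w \<in> {1..s}" "c0 t \<in> {1..s}" using s by auto
  have add: "f + g \<in> bit_fun_space n" if "f \<in> bit_fun_space n" "g \<in> bit_fun_space n" for f g n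
    using that by (simp add: bit_fun_space_def)
  have can: "f + (f + g) = g" "(f + g) + g = f" "(f + g) + f = g" for f g :: "nat \<Rightarrow> bit"
    using binary_dual.add_left_self[OF binary_dual_bit_fun_space, of f g]
      binary_dual.add_right_self[OF binary_dual_bit_fun_space] by (simp_all add: add.commute)
  have nz: "f + g \<noteq> 0" if "f \<noteq> g" for f g :: "nat \<Rightarrow> bit"
    using binary_dual.add_eq_0_iff'[OF binary_dual_bit_fun_space, of f g] that by blast
  have ne: "f + g \<noteq> g" "f + g \<noteq> f" if "f \<noteq> 0" "g \<noteq> 0" for f g :: "nat \<Rightarrow> bit"
    using that by auto
  note tri = pg_contains_triangleI[folded u_def w_def t_def]
  have "c0 u = c0 w \<or> c0 u = c0 t \<or> c0 w = c0 t" using range s(1) by auto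
  then show ?thesis
  proof (elim disjE)
    assume eq: "c0 u = c0 w"
    show ?thesis
    proof (rule bexI[OF bexI[OF _ rs(3)] rs(1)], intro allI impI notI)
      fix n c f g assume "pg_free n c 2 c0" "f \<in> bit_fun_space n" "g \<in> bit_fun_space n" "f \<noteq> 0" "g \<noteq> 0" "f \<noteq> g"
        "c (vec n f) = c0 u" "c (vec n g) = c0 u" "c (vec n (f + g)) = c0 t"
      then show False using tri[of f n g c c0] eq by simp
    qed
  next
    assume eq: "c0 u = c0 t"
    show ?thesis
    proof (rule bexI[OF bexI[OF _ rs(2)] rs(1)], intro allI impI notI)
      fix n c f g assume "pg_free n c 2 c0" "f \<in> bit_fun_space n" "g \<in> bit_fun_space n" "f \<noteq> 0" "g \<noteq> 0" "f \<noteq> g"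
        "c (vec n f) = c0 u" "c (vec n g) = c0 u" "c (vec n (f + g)) = c0 w"
      \<comment> \<open>Taking \<open>f\<close> and \<open>f + g\<close> as the images of the unit
        vectors makes \<open>g\<close> the image of their sum.\<close>
      then show False using tri[of f n "f + g" c c0] eq add nz ne by (simp add: can)
    qed
  next
    assume eq: "c0 w = c0 t"
    show ?thesis
    proof (rule bexI[OF bexI[OF _ rs(1)] rs(2)], intro allI impI notI)
      fix n c f g assume "pg_free n c 2 c0" "f \<in> bit_fun_space n" "g \<in> bit_fun_space n" "f \<noteq> 0" "g \<noteq> 0" "f \<noteq> g"
        "c (vec n f) = c0 w" "c (vec n g) = c0 w" "c (vec n (f + g)) = c0 u"
      then show False using tri[of "f + g" n g c c0] eq add nz ne by (simp add: can)
    qed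
  qed
qed

text \<open>Covers the small \<open>n\<close>: a single point has only one colour, so it avoids one
  of the others.\<close>

lemma pg_line_avoiding_colour:
  fixes c :: "bit vec \<Rightarrow> nat"
  assumes s: "2 \<le> s" and n: "1 \<le> n"
  shows "\<exists>V i. pg_subspace n V \<and> 1 \<le> pg_dim n V \<and> i \<in> {1..s} \<and> (\<forall>x\<in>V. c x \<noteq> i)"
proof -
  define v :: "bit vec" where "v = vec n (\<lambda>_. 1)"
  have v: "v \<in> carrier_vec n" "v \<noteq> 0\<^sub>v n"
  proof -
    have "v $ 0 \<noteq> 0\<^sub>v n $ 0" using n by (simp add: v_def)
    then show "v \<noteq> 0\<^sub>v n" by auto
  qed (simp add: v_def)
  have "v + v = 0\<^sub>v n" by (intro eq_vecI) (auto simp: v_def)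
  then have W: "{0\<^sub>v n, v} \<subseteq> carrier_vec n" "0\<^sub>v n \<in> {0\<^sub>v n, v}"
    "\<And>x y. x \<in> {0\<^sub>v n, v} \<Longrightarrow> y \<in> {0\<^sub>v n, v} \<Longrightarrow> x + y \<in> {0\<^sub>v n, v}"
    "card {0\<^sub>v n, v} = 2 ^ 1"
    using v by auto
  define i where "i = (if c v = 1 then 2 else 1 :: nat)"
  have "i \<in> {1..s}" "\<forall>x\<in>{0\<^sub>v n, v} - {0\<^sub>v n}. c x \<noteq> i" using s by (auto simp: i_def)
  with pg_subspace_of_closed[OF W] show ?thesis by blast
qed

lemma pg_large_subspace_avoiding_colour:
  fixes c :: "bit vec \<Rightarrow> nat"
  assumes ab: "a \<in> {1..s}" "b \<in> {1..s}"
    and free: "\<And>f g. f \<in> bit_fun_space n \<Longrightarrow> g \<in> bit_fun_space n \<Longrightarrow> f \<noteq> 0 \<Longrightarrow> g \<noteq> 0 \<Longrightarrow> f \<noteq> g \<Longrightarrow>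
      c (vec n f) = a \<Longrightarrow> c (vec n g) = a \<Longrightarrow> c (vec n (f + g)) \<noteq> b"
    and n: "23 * codim_const * Suc k ^ 7 + Suc k \<le> n"
  shows "\<exists>V i. pg_subspace n V \<and> k \<le> pg_dim n V \<and> i \<in> {1..s} \<and> (\<forall>x\<in>V. c x \<noteq> i)"
proof -
  interpret binary_dual "bit_fun_space n" "Pow {..<n}" sign_char by (rule binary_dual_bit_fun_space)
  \<comment> \<open>Zero is left out of both classes because it lies in every subgroup and is not a
    point. This also settles the sums \<open>f + f\<close>.\<close>
  define A where "A = {f \<in> bit_fun_space n. f \<noteq> 0 \<and> c (vec n f) = a}"
  define B where "B = {f \<in> bit_fun_space n. f \<noteq> 0 \<and> c (vec n f) = b}"
  have "2 ^ (23 * codim_const * Suc k ^ 7 + Suc k) \<le> card (bit_fun_space n)"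
    unfolding card_bit_fun_space using n by (intro power_increasing) auto
  moreover have "f + g \<notin> B" if fg: "f \<in> A" "g \<in> A" for f g
  proof (cases "f = g")
    case True
    then show ?thesis by (simp add: B_def)
  next
    case False
    then show ?thesis using free[of f g] fg by (auto simp: A_def B_def)
  qed
  ultimately obtain W where W: "subgrp W" "card W = 2 ^ k" and "W \<inter> A = {} \<or> W \<inter> B = {}"
    using sum_avoiding_subgroup[of A B k] by (auto simp: A_def B_def)
  then obtain i where i: "i \<in> {1..s}" and avoid: "\<And>f. f \<in> W \<Longrightarrow> f \<noteq> 0 \<Longrightarrow> c (vec n f) \<noteq> i"
    using ab subgrpD(1)[OF W(1)] unfolding A_def B_def by blast
  have vec0: "vec n 0 = (0\<^sub>v n :: bit vec)" by (intro eq_vecI) auto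
  have inj: "inj_on (vec n) W" using inj_on_vec subgrpD(1)[OF W(1)] by (rule inj_on_subset)
  have W1: "vec n ` W \<subseteq> carrier_vec n" by auto
  have W2: "0\<^sub>v n \<in> vec n ` W" using subgrpD(2)[OF W(1)] vec0 by (metis imageI)
  have W3: "x + y \<in> vec n ` W" if "x \<in> vec n ` W" "y \<in> vec n ` W" for x y
    using that subgrpD(3)[OF W(1)] by (auto simp: vec_add_fun[symmetric])
  have W4: "card (vec n ` W) = 2 ^ k" using card_image[OF inj] W(2) by simp
  have "\<forall>x\<in>vec n ` W - {0\<^sub>v n}. c x \<noteq> i" using avoid vec0 by auto
  with pg_subspace_of_closed[OF W1 W2 W3 W4] i show ?thesis by blast
qed

theorem theorem1p5:
  fixes s0 s :: nat and c0 :: "bit vec \<Rightarrow> nat"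
  assumes "s0 \<in> {1, 2}"
    and "s0 \<le> s"
    and "pg_colouring s0 2 c0"
  shows "\<exists>C::real. C > 0 \<and>
    (\<forall>(n::nat) c. \<not> (s = 1 \<and> n = 1) \<longrightarrow> pg_colouring s n c \<longrightarrow> pg_free n c 2 c0 \<longrightarrow>
      (\<exists>V i. pg_subspace n V \<and> real (pg_dim n V) \<ge> C * real n powr (1 / 7) \<and>
             i \<in> {1..s} \<and> (\<forall>x\<in>V. c x \<noteq> i)))"
proof -
  obtain a b where ab: "a \<in> {1..s}" "b \<in> {1..s}"
    and free: "\<And>n c f g. pg_free n c 2 c0 \<Longrightarrow> f \<in> bit_fun_space n \<Longrightarrow> g \<in> bit_fun_space n \<Longrightarrow>
      f \<noteq> 0 \<Longrightarrow> g \<noteq> 0 \<Longrightarrow> f \<noteq> g \<Longrightarrow> c (vec n f) = a \<Longrightarrow> c (vec n g) = a \<Longrightarrow> c (vec n (f + g)) \<noteq> b"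
    using monochromatic_pair[OF assms] by metis
  \<comment> \<open>The 24 is 23 for the exponent \<open>23 * codim_const * Suc k ^ 7\<close>, plus
    1 to absorb the remaining \<open>Suc k\<close>.\<close>
  define M where "M = 24 * real codim_const"
  have M: "M > 0" by (simp add: M_def codim_const_def)
  \<comment> \<open>Chosen so that the required dimension is \<open>y / 3\<close> for the number
    \<open>y\<close> below; the 3 covers rounding \<open>y\<close> down to \<open>k\<close>.\<close>
  define C where "C = 1 / (3 * M powr (1 / 7))"
  have "\<exists>V i. pg_subspace n V \<and> real (pg_dim n V) \<ge> C * real n powr (1 / 7) \<and> i \<in> {1..s} \<and> (\<forall>x\<in>V. c x \<noteq> i)"
    if sn: "\<not> (s = 1 \<and> n = 1)" and col: "pg_colouring s n c" and fr: "pg_free n c 2 c0" for n c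
  proof (cases "n = 0")
    case True
    \<comment> \<open>For \<open>n = 0\<close> the required dimension is 0, as
      \<open>0 powr (1 / 7) = 0\<close>, so the empty subspace suffices.\<close>
    have "pg_subspace n ({0\<^sub>v n} - {0\<^sub>v n})"
      by (rule pg_subspace_of_closed(1)[where k = 0]) auto
    with True ab show ?thesis by (intro exI[of _ "{}"] exI[of _ a]) simp
  next
    case n0: False
    \<comment> \<open>If \<open>s = 1\<close>, then \<open>n \<ge> 2\<close> and all points have
      colour 1, so two distinct unit vectors contradict freeness.\<close>
    have s2: "2 \<le> s"
    proof (rule ccontr)
      assume "\<not> 2 \<le> s"
      then have s1: "s = 1" "s0 = 1" using assms by auto
      then have n2: "2 \<le> n" using sn n0 by simp
      have one: "c (vec n f) = 1" if "f \<in> bit_fun_space n" "f \<noteq> 0" for f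
      proof -
        have "vec n f \<noteq> vec n 0"
          using inj_onD[OF inj_on_vec, of n f 0] that by (auto simp: bit_fun_space_def)
        moreover have "vec n 0 = (0\<^sub>v n :: bit vec)" by (intro eq_vecI) auto
        ultimately have "vec n f \<in> pg_points n" by (simp add: pg_points_def)
        then show ?thesis using col s1 by (auto simp: pg_colouring_def)
      qed
      define f g :: "nat \<Rightarrow> bit" where "f = (\<lambda>i. if i = 0 then 1 else 0)" and "g = (\<lambda>i. if i = 1 then 1 else 0)"
      have fg: "f \<in> bit_fun_space n" "g \<in> bit_fun_space n" "f + g \<in> bit_fun_space n"
        using n2 by (auto simp: bit_fun_space_def f_def g_def)
      have v: "f 0 = 1" "f 1 = 0" "g 0 = 0" "g 1 = 1" by (auto simp: f_def g_def)
      then have ne: "f \<noteq> 0" "g \<noteq> 0" "f \<noteq> g" by (metis zero_fun_apply zero_neq_one)+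
      have "(f + g) 0 = 1" using v by simp
      then have "f + g \<noteq> 0" by (metis zero_fun_apply zero_neq_one)
      then have "c (vec n (f + g)) = 1" using one fg by blast
      moreover have "a = 1" "b = 1" using ab s1 by auto
      ultimately show False using free[OF fr fg(1,2) ne] one fg ne by simp
    qed
    define y where "y = (real n / M) powr (1 / 7)"
    have y0: "y > 0" using n0 M by (simp add: y_def)
    have Cy: "C * real n powr (1 / 7) = y / 3"
      using M by (simp add: C_def y_def powr_divide)
    have y7: "y ^ 7 = real n / M"
      using n0 M by (simp add: y_def powr_realpow[symmetric] powr_powr)
    show ?thesis
    proof (cases "y < 2")
      case True
      \<comment> \<open>For \<open>y < 2\<close> the required dimension is below 1, so one point is
        enough.\<close>
      obtain V i where "pg_subspace n V" "1 \<le> pg_dim n V" "i \<in> {1..s}" "\<forall>x\<in>V. c x \<noteq> i"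
        using pg_line_avoiding_colour[OF s2, of n c] n0 by auto
      moreover from this have "real (pg_dim n V) \<ge> C * real n powr (1 / 7)" using True by (simp add: Cy)
      ultimately show ?thesis by blast
    next
      case False
      \<comment> \<open>Here \<open>Suc k\<close> is the integer part of \<open>y\<close>, so
        \<open>M * Suc k ^ 7 \<le> n\<close>, while \<open>k \<ge> 1\<close> gives
        \<open>y < k + 2 \<le> 3 * k\<close>.\<close>
      define k where "k = nat \<lfloor>y\<rfloor> - 1"
      have k: "real (Suc k) \<le> y" "y < real k + 2" "1 \<le> k"
      proof -
        have "2 \<le> \<lfloor>y\<rfloor>" using False by linarith
        then have "2 \<le> nat \<lfloor>y\<rfloor>" "real (nat \<lfloor>y\<rfloor>) = of_int \<lfloor>y\<rfloor>" by linarith+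
        then have "real (Suc k) = of_int \<lfloor>y\<rfloor>" "1 \<le> k" by (auto simp: k_def of_nat_diff)
        then show "real (Suc k) \<le> y" "y < real k + 2" "1 \<le> k" by linarith+
      qed
      have "real (Suc k) ^ 7 \<le> real n / M" unfolding y7[symmetric] by (rule power_mono[OF k(1)]) simp
      then have "real (24 * codim_const * Suc k ^ 7) \<le> real n" using M by (simp add: M_def field_simps)
      then have "24 * codim_const * Suc k ^ 7 \<le> n" by (simp only: of_nat_le_iff)
      moreover have "Suc k * 1 \<le> Suc k ^ 7 * codim_const"
        using self_le_power[of "Suc k" 7] by (intro mult_mono) (simp_all add: codim_const_def)
      ultimately have "23 * codim_const * Suc k ^ 7 + Suc k \<le> n" by (simp add: algebra_simps)
      from pg_large_subspace_avoiding_colour[where c = c, OF ab free[OF fr] this]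
      obtain V i where V: "pg_subspace n V" "k \<le> pg_dim n V" "i \<in> {1..s}" "\<forall>x\<in>V. c x \<noteq> i" by blast
      have "y / 3 \<le> real k" using k by simp
      also have "\<dots> \<le> real (pg_dim n V)" using V(2) by simp
      finally have "real (pg_dim n V) \<ge> C * real n powr (1 / 7)" by (simp add: Cy)
      with V show ?thesis by blast
    qed
  qed
  moreover have "C > 0" using M by (simp add: C_def)
  ultimately show ?thesis by blast
qed

end
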